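(* Let $\mathcal{E}$ be a unital qubit channel with Stokes matrix $R$, let $S=\begin{pmatrix}R_{zz}&R_{zx}\\R_{xz}&R_{xx}\end{pmatrix}$ and write $S=V\,\mathrm{diag}[d_z,d_x]\,U$ with $U,V\in SO(2)$ and real $d_z,d_x$. For $j\in\{z,x\}$ let $\langle V_j|$ be the $j$-th row of $V$ and $|\tilde U_j\rangle$ the $j$-th column of $\mathrm{diag}[d_z,d_x]U$ (so $S_{ij}=\langle V_i|\tilde U_j\rangle$). Let $Q_A^*=U^{-1}$, $Q_B^*=V^{-1}$, let $\mathcal{U}_A^*,\mathcal{U}_B^*$ be the corresponding $z$–$x$ plane rotation channels and $\mathcal{E}^*=\mathcal{U}_B^*\circ\mathcal{E}\circ\mathcal{U}_A^*$, with $\omega^*$ its parameter vector $(R^*_{zz},R^*_{zx},R^*_{xz},R^*_{xx},t^*_z,t^*_x)$. Then $$G_2(\mathcal{E})=\min_{\tilde{\mathcal{E}}\in\mathcal{P}_{ba}(\omega^* )}K(\tilde{\mathcal{E}})=1-h\Big(\frac{1+d_z}{2}\Big)-h\Big(\frac{1+d_x}{2}\Big).$$ Furthermore, the maximum defining $G_2(\mathcal{E})$ is achieved without any compensation, i.e. $\min_{\tilde{\mathcal{E}}\in\mathcal{P}_{ba}(\omega)}K(\tilde{\mathcal{E}})=\min_{\tilde{\mathcal{E}}\in\mathcal{P}_{ba}(\omega^* )}K(\tilde{\mathcal{E}})$ with $\omega$ the parameter vector of $\mathcal{E}$, if and only if $|\tilde U_z\rangle$ and $|V_z\rangle$ are scalar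 multiples of each other.
   Context: A qubit channel is described by its Stokes parameterization $(R,t)$: in Bloch coordinates $(\theta_z,\theta_x,\theta_y)$, $\theta_a=\mathrm{Tr}(\rho\sigma_a)$, it acts as $\theta\mapsto R\theta+t$ (indices ordered $z,x,y$); unital means $t=0$. A unitary channel inducing a rotation of the Bloch sphere within the $z$–$x$ plane (i.e. fixing the $y$ axis) corresponds to a rotation matrix $\begin{pmatrix}Q&0\\0&1\end{pmatrix}$ with $Q\in SO(2)$; for such $\mathcal{U}_A,\mathcal{U}_B$ (with $Q_A,Q_B$), $\mathcal{E}'=\mathcal{U}_B\circ\mathcal{E}\circ\mathcal{U}_A$ has upper-left $2\times2$ block $S'=Q_BSQ_A$. For a qubit channel $\mathcal{F}$ with complementary (environment) channel $\mathcal{F}_E$, and $|0_z\rangle,|1_z\rangle$ the $\pm1$ eigenvectors of $\sigma_z$: $H_{\mathcal{F}}(X|E)=H(\rho_{XE})-H(\rho_E)$ (von Neumann, base 2) for $\rho_{XE}=\sum_x\frac12|x_z\rangle\langle x_z|\otimes\mathcal{F}_E(|x_z\rangle\langle x_z|)$; $H_{\mathcal{F}}(X|Y)$ is the conditional Shannon entropy for $P_{XY}(x,y)=\frac12\langle y_z|\mathcal{F}(|x_z\rangle\langle x_z|)|y_z\rangle$; $K(\mathcal{F})=H_{\mathcal{F}}(X|E)-H_{\mathcal{F}}(X|Y)$; $h$ is the binary entropy function (base 2). For $\omega\in\mathbb{R}^6$, $\mathcal{P}_{ba}(\omega)$ is the set of all qubit channels whose parameters $(R_{zz},R_{zx},R_{xz},R_{xx},t_z,t_x)$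 equal $\omega$ (the remaining Stokes parameters arbitrary). $G_2(\mathcal{E})=\max_{\mathcal{U}_A,\mathcal{U}_B}\min_{\tilde{\mathcal{E}}\in\mathcal{P}_{ba}(\omega')}K(\tilde{\mathcal{E}})$, maximum over $z$–$x$ plane rotation channels, where $\omega'$ is the parameter vector $(R'_{zz},R'_{zx},R'_{xz},R'_{xx},t'_z,t'_x)$ of $\mathcal{E}'=\mathcal{U}_B\circ\mathcal{E}\circ\mathcal{U}_A$. *)

theory Defs
  imports "Jordan_Normal_Form.Char_Poly"
begin

(* Conventions: Bloch/Stokes indices 0 = z, 1 = x, 2 = y.
   Computational basis: index 0 = |0_z> (+1 eigenvector of sigma_z), index 1 = |1_z>. *)

definition mtrace :: "'a::comm_ring_1 mat \<Rightarrow> 'a" where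
  "mtrace A = (\<Sum>i<dim_row A. A $$ (i,i))"

definition cadj :: "complex mat \<Rightarrow> complex mat" where
  "cadj A = mat (dim_col A) (dim_row A) (\<lambda>(i,j). cnj (A $$ (j,i)))"

definition sigma_z :: "complex mat" where
  "sigma_z = mat_of_rows_list 2 [[1,0],[0,-1]]"
definition sigma_x :: "complex mat" where
  "sigma_x = mat_of_rows_list 2 [[0,1],[1,0]]"
definition sigma_y :: "complex mat" where
  "sigma_y = mat_of_rows_list 2 [[0,-\<i>],[\<i>,0]]"

definition pauli :: "nat \<Rightarrow> complex mat" where
  "pauli a = (if a = 0 then sigma_z else if a = 1 then sigma_x else sigma_y)"

definition density :: "complex mat \<Rightarrow> bool" where
  "density \<rho> \<longleftrightarrow> \<rho> \<in> carrier_mat 2 2 \<and> cadj \<rho> = \<rho> \<and> mtrace \<rho> = 1 \<and>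
     (\<forall>v \<in> carrier_vec 2. 0 \<le> Re (\<Sum>i<2. cnj (v $ i) * (\<rho> *\<^sub>v v) $ i))"

definition bloch :: "complex mat \<Rightarrow> real vec" where
  "bloch \<rho> = vec 3 (\<lambda>a. Re (mtrace (\<rho> * pauli a)))"

definition stokes_map :: "real mat \<Rightarrow> real vec \<Rightarrow> complex mat \<Rightarrow> complex mat" where
  "stokes_map R t \<rho> = (let r = R *\<^sub>v bloch \<rho> + t in
     (1/2) \<cdot>\<^sub>m (1\<^sub>m 2 + complex_of_real (r $ 0) \<cdot>\<^sub>m sigma_z
        + complex_of_real (r $ 1) \<cdot>\<^sub>m sigma_x + complex_of_real (r $ 2) \<cdot>\<^sub>m sigma_y))"

definition kraus_apply :: "complex mat list \<Rightarrow> complex mat \<Rightarrow> complex mat" where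
  "kraus_apply Ks \<rho> = foldr (\<lambda>K acc. K * \<rho> * cadj K + acc) Ks (0\<^sub>m 2 2)"

definition kraus_tp :: "complex mat list \<Rightarrow> complex mat" where
  "kraus_tp Ks = foldr (\<lambda>K acc. cadj K * K + acc) Ks (0\<^sub>m 2 2)"

definition is_kraus_rep :: "real mat \<Rightarrow> real vec \<Rightarrow> complex mat list \<Rightarrow> bool" where
  "is_kraus_rep R t Ks \<longleftrightarrow> Ks \<noteq> [] \<and> set Ks \<subseteq> carrier_mat 2 2 \<and> kraus_tp Ks = 1\<^sub>m 2 \<and>
     (\<forall>\<rho>. density \<rho> \<longrightarrow> kraus_apply Ks \<rho> = stokes_map R t \<rho>)"

definition is_channel :: "real mat \<Rightarrow> real vec \<Rightarrow> bool" where
  "is_channel R t \<longleftrightarrow> R \<in> carrier_mat 3 3 \<and> t \<in> carrier_vec 3 \<and> (\<exists>Ks. is_kraus_rep R t Ks)"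

(* a Kraus representation of the channel; the complementary channel is built from it
   (entropic quantities below do not depend on this choice) *)
definition kraus_of :: "real mat \<Rightarrow> real vec \<Rightarrow> complex mat list" where
  "kraus_of R t = (SOME Ks. is_kraus_rep R t Ks)"

definition compl_channel :: "real mat \<Rightarrow> real vec \<Rightarrow> complex mat \<Rightarrow> complex mat" where
  "compl_channel R t \<rho> = (let Ks = kraus_of R t; n = length Ks in
     mat n n (\<lambda>(k,l). mtrace (Ks ! k * \<rho> * cadj (Ks ! l))))"

definition zproj :: "nat \<Rightarrow> complex mat" where
  "zproj x = mat 2 2 (\<lambda>(i,j). if i = x \<and> j = x then 1 else 0)"

definition eta :: "real \<Rightarrow> real" where
  "eta p = (if p \<le> 0 then 0 else - p * log 2 p)"

definition bin_entropy :: "real \<Rightarrow> real" where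
  "bin_entropy p = eta p + eta (1 - p)"

definition vn_entropy :: "complex mat \<Rightarrow> real" where
  "vn_entropy A = (\<Sum>e \<in> {e. poly (char_poly A) e = 0}.
       real (order e (char_poly A)) * eta (Re e))"

definition H_XE :: "real mat \<Rightarrow> real vec \<Rightarrow> real" where
  "H_XE R t = (let n = length (kraus_of R t);
      A = (1/2) \<cdot>\<^sub>m compl_channel R t (zproj 0);
      B = (1/2) \<cdot>\<^sub>m compl_channel R t (zproj 1)
    in vn_entropy (four_block_mat A (0\<^sub>m n n) (0\<^sub>m n n) B) - vn_entropy (A + B))"

definition P_XY :: "real mat \<Rightarrow> real vec \<Rightarrow> nat \<Rightarrow> nat \<Rightarrow> real" where
  "P_XY R t x y = (1/2) * Re (stokes_map R t (zproj x) $$ (y,y))"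

definition H_XY :: "real mat \<Rightarrow> real vec \<Rightarrow> real" where
  "H_XY R t = (\<Sum>x<2. \<Sum>y<2. eta (P_XY R t x y)) - (\<Sum>y<2. eta (P_XY R t 0 y + P_XY R t 1 y))"

definition key_rate :: "real mat \<Rightarrow> real vec \<Rightarrow> real" where
  "key_rate R t = H_XE R t - H_XY R t"

definition params :: "real mat \<Rightarrow> real vec \<Rightarrow> real \<times> real \<times> real \<times> real \<times> real \<times> real" where
  "params R t = (R $$ (0,0), R $$ (0,1), R $$ (1,0), R $$ (1,1), t $ 0, t $ 1)"

definition P_ba :: "real \<times> real \<times> real \<times> real \<times> real \<times> real \<Rightarrow> (real mat \<times> real vec) set" where
  "P_ba \<omega> = {(R,t). is_channel R t \<and> params R t = \<omega>}"

definition min_K :: "real \<times> real \<times> real \<times> real \<times> real \<times> real \<Rightarrow> real" where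
  "min_K \<omega> = Inf ((\<lambda>(R,t). key_rate R t) ` P_ba \<omega>)"

definition SO2 :: "real mat set" where
  "SO2 = {Q. Q \<in> carrier_mat 2 2 \<and> Q * transpose_mat Q = 1\<^sub>m 2 \<and> det Q = 1}"

definition rot_channel :: "real mat \<Rightarrow> real mat \<times> real vec" where
  "rot_channel Q = (mat 3 3 (\<lambda>(i,j). if i < 2 \<and> j < 2 then Q $$ (i,j) else if i = j then 1 else 0), 0\<^sub>v 3)"

definition stokes_comp :: "real mat \<times> real vec \<Rightarrow> real mat \<times> real vec \<Rightarrow> real mat \<times> real vec" where
  "stokes_comp F2 F1 = (fst F2 * fst F1, fst F2 *\<^sub>v snd F1 + snd F2)"

definition compensate :: "real mat \<Rightarrow> real vec \<Rightarrow> real mat \<Rightarrow> real mat \<Rightarrow> real mat \<times> real vec" where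
  "compensate R t QA QB = stokes_comp (rot_channel QB) (stokes_comp (R,t) (rot_channel QA))"

definition G2 :: "real mat \<Rightarrow> real vec \<Rightarrow> real" where
  "G2 R t = Sup {min_K (case_prod params (compensate R t QA QB)) | QA QB. QA \<in> SO2 \<and> QB \<in> SO2}"

definition is_maximum :: "real set \<Rightarrow> real \<Rightarrow> bool" where
  "is_maximum A v \<longleftrightarrow> v \<in> A \<and> (\<forall>a\<in>A. a \<le> v)"

definition is_minimum :: "real set \<Rightarrow> real \<Rightarrow> bool" where
  "is_minimum A v \<longleftrightarrow> v \<in> A \<and> (\<forall>a\<in>A. v \<le> a)"

end

theory Submission
  imports "HOL-Analysis.Henstock_Kurzweil_Integration" Defs "Jordan_Normal_Form.Schur_Decomposition"
begin

text \<open>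
  Let \<open>\<rho>\<close> be the Choi state of a channel, in \<open>2 \<times> 2\<close> blocks indexed by the input, and \<open>Z \<rho>\<close> its
  block diagonal part. Since \<open>M M\<^sup>*\<close> and \<open>M\<^sup>* M\<close> have the same nonzero spectrum,
  \<open>H(X|E) = H(Z \<rho>) - H(\<rho>)\<close>, while \<open>H(X|Y)\<close> depends only on the observed parameters.

  Among the channels with a given \<open>z\<close>-\<open>x\<close> block with signed singular values \<open>dz\<close>, \<open>dx\<close>, the one
  with vanishing remaining parameters except \<open>R\<^sub>y\<^sub>y = dz dx\<close> has key rate
  \<open>1 + h((1 + \<surd>(R\<^sub>z\<^sub>z\<^sup>2 + R\<^sub>x\<^sub>z\<^sup>2)) / 2) - h((1 + R\<^sub>z\<^sub>z) / 2) - h((1 + dz) / 2) - h((1 + dx) / 2)\<close>.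
  As \<open>h((1 + x) / 2)\<close> is strictly decreasing in \<open>\<bar>x\<bar>\<close>, this is at most the claimed value, with
  equality iff \<open>R\<^sub>x\<^sub>z = 0\<close>, that is, iff the two vectors of the theorem are parallel.

  If \<open>R\<^sub>x\<^sub>z = 0\<close>, every channel with these parameters satisfies the reverse bound: with \<open>\<sigma>\<close> the Choi
  state of the special channel, \<open>D(\<rho> | \<sigma>) \<ge> D(Z \<rho> | Z \<sigma>)\<close> rearranges to
  \<open>H(Z \<rho>) - H(\<rho>) \<ge> tr (\<rho> (log \<sigma> - log Z \<sigma>))\<close>, and the right side depends only on the observed
  parameters. As \<open>Z\<close> averages over a unitary conjugation, this instance of monotonicity follows from
  joint convexity of relative entropy, which in turn holds because relative entropy is an integral of
  \<open>\<chi>\<^sup>2\<close>-type quantities that are suprema of functions linear in \<open>(\<rho>, \<sigma>)\<close>.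
\<close>

unbundle no vec_syntax

section \<open>Adjoints\<close>

lemma less_2_iff: "(i :: nat) < 2 \<longleftrightarrow> i = 0 \<or> i = 1" by auto

lemma less_4_iff: "(i :: nat) < 4 \<longleftrightarrow> i = 0 \<or> i = 1 \<or> i = 2 \<or> i = 3" by auto

lemma sum_lessThan_2: "(\<Sum>i<2. f i) = f 0 + f (1 :: nat)"
  by (simp add: numeral_2_eq_2)

lemma sum_lessThan_3: "(\<Sum>i<3. f i) = f 0 + f 1 + f (2 :: nat)"
  by (simp add: numeral_3_eq_3 numeral_2_eq_2)

lemma sum_lessThan_4: "(\<Sum>i<4. f i) = f 0 + f 1 + f 2 + f (3 :: nat)"
proof -
  have "{..<4} = {0,1,2,3 :: nat}" by auto
  thus ?thesis by (simp add: add.assoc)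
qed

lemma cadj_carrier [simp]: "A \<in> carrier_mat n m \<Longrightarrow> cadj A \<in> carrier_mat m n"
  by (auto simp: cadj_def)

lemma dim_cadj [simp]: "dim_row (cadj A) = dim_col A" "dim_col (cadj A) = dim_row A"
  by (auto simp: cadj_def)

lemma index_cadj [simp]:
  "i < dim_col A \<Longrightarrow> j < dim_row A \<Longrightarrow> cadj A $$ (i,j) = cnj (A $$ (j,i))"
  by (auto simp: cadj_def)

lemma cadj_cadj [simp]: "cadj (cadj A) = A"
  by (rule eq_matI) auto

lemma cadj_one [simp]: "cadj (1\<^sub>m n) = 1\<^sub>m n"
  by (rule eq_matI) auto

lemma cadj_zero [simp]: "cadj (0\<^sub>m n m) = 0\<^sub>m m n"
  by (rule eq_matI) auto

lemma cadj_add: "dim_row A = dim_row B \<Longrightarrow> dim_col A = dim_col B \<Longrightarrow> cadj (A + B) = cadj A + cadj B"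
  by (rule eq_matI) auto

lemma cadj_smult: "cadj (c \<cdot>\<^sub>m A) = cnj c \<cdot>\<^sub>m cadj A"
  by (rule eq_matI) auto

lemma index_mult_mat_sum:
  assumes "i < dim_row A" "j < dim_col B" "dim_col A = dim_row B"
  shows "(A * B) $$ (i,j) = (\<Sum>l<dim_col A. A $$ (i,l) * B $$ (l,j))"
  using assms by (simp add: scalar_prod_def lessThan_atLeast0)

lemma mult_mat_assoc:
  fixes A B C :: "'a::semiring_0 mat"
  assumes "dim_col A = dim_row B" "dim_col B = dim_row C"
  shows "A * B * C = A * (B * C)"
  using assms by (intro assoc_mult_mat[of _ "dim_row A" "dim_col A" _ "dim_col B" _ "dim_col C"]) auto

lemma cadj_mult:
  assumes "dim_col A = dim_row B"
  shows "cadj (A * B) = cadj B * cadj A"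
  by (rule eq_matI) (use assms
    in \<open>simp_all add: index_mult_mat_sum mult.commute del: index_mult_mat(1)\<close>)

lemma cadj_four_block_mat:
  assumes "A \<in> carrier_mat n1 m1" "B \<in> carrier_mat n1 m2" "C \<in> carrier_mat n2 m1"
    "D \<in> carrier_mat n2 m2"
  shows "cadj (four_block_mat A B C D) = four_block_mat (cadj A) (cadj C) (cadj B) (cadj D)"
  by (rule eq_matI) (use assms in auto)

lemma mult_four_block_diag:
  fixes A B C D :: "'a::comm_semiring_1 mat"
  assumes "A \<in> carrier_mat n1 n" "B \<in> carrier_mat m1 m" "C \<in> carrier_mat n n2" "D \<in> carrier_mat m m2"
  shows "four_block_mat A (0\<^sub>m n1 m) (0\<^sub>m m1 n) B * four_block_mat C (0\<^sub>m n m2) (0\<^sub>m m n2) D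
    = four_block_mat (A * C) (0\<^sub>m n1 m2) (0\<^sub>m m1 n2) (B * D)"
  using assms mult_carrier_mat[OF assms(1,3)] mult_carrier_mat[OF assms(2,4)]
  by (simp add: mult_four_block_mat[of _ n1 n _ m _ m1 _ _ n2 _ m2])

lemma cadj_gram_mat: "cadj (cadj M * M) = cadj M * M"
  by (simp add: cadj_mult)

section \<open>Unitary matrices and spectral decompositions\<close>

definition unitary_mat :: "nat \<Rightarrow> complex mat \<Rightarrow> bool" where
  "unitary_mat n U \<longleftrightarrow> U \<in> carrier_mat n n \<and> cadj U * U = 1\<^sub>m n"

lemma unitary_matD:
  assumes "unitary_mat n U"
  shows "U \<in> carrier_mat n n" "dim_row U = n" "dim_col U = n" "cadj U * U = 1\<^sub>m n" "U * cadj U = 1\<^sub>m n"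
  using assms mat_mult_left_right_inverse[of "cadj U" n U] by (auto simp: unitary_mat_def)

lemma unitary_mat_one: "unitary_mat n (1\<^sub>m n)"
  by (simp add: unitary_mat_def)

lemma unitary_mat_cadj: "unitary_mat n U \<Longrightarrow> unitary_mat n (cadj U)"
  using unitary_matD(1,5)[of n U] by (simp add: unitary_mat_def[of n "cadj U"])

lemma unitary_mat_cancel:
  assumes "unitary_mat n U" "dim_row A = n"
  shows "cadj U * (U * A) = A" "U * (cadj U * A) = A"
  using unitary_matD[OF assms(1)] assms(2) mult_mat_assoc[of "cadj U" U A]
    mult_mat_assoc[of U "cadj U" A]
  by simp_all

lemma cadj_mult_unitary:
  assumes "unitary_mat n D" "dim_row U = n" "dim_row V = n"
  shows "cadj (D * V) * (D * U) = cadj V * U"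
  using assms unitary_matD(2,3)[OF assms(1)] by (simp add: cadj_mult mult_mat_assoc unitary_mat_cancel)

lemma unitary_mat_mult:
  assumes "unitary_mat n U" "unitary_mat n V"
  shows "unitary_mat n (U * V)"
  using unitary_matD(1)[OF assms(1)] unitary_matD(1,2,4)[OF assms(2)]
  by (simp add: unitary_mat_def[of n "U * V"] cadj_mult_unitary[OF assms(1)] mult_carrier_mat[of _ n n])

lemma complex_of_real_cmod_sq: "complex_of_real ((cmod z)\<^sup>2) = cnj z * z"
  by (simp only: complex_norm_square mult.commute)

lemma unitary_mat_col_norm:
  assumes "unitary_mat n U" "i < n"
  shows "(\<Sum>j<n. (cmod (U $$ (j,i)))\<^sup>2) = 1"
proof -
  have "complex_of_real (\<Sum>j<n. (cmod (U $$ (j,i)))\<^sup>2) = (cadj U * U) $$ (i,i)"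
    using assms unitary_matD(2,3)[OF assms(1)] unfolding of_real_sum complex_of_real_cmod_sq
    by (simp add: index_mult_mat_sum del: index_mult_mat(1))
  thus ?thesis using assms by (simp add: unitary_matD(4) flip: of_real_sum)
qed

lemma unitary_mat_row_norm:
  assumes "unitary_mat n U" "i < n"
  shows "(\<Sum>j<n. (cmod (U $$ (i,j)))\<^sup>2) = 1"
  using unitary_mat_col_norm[OF unitary_mat_cadj[OF assms(1)] assms(2)] unitary_matD(1)[OF assms(1)]
    assms(2)
  by simp

lemma unitary_mat_four_block:
  assumes "unitary_mat n U" "unitary_mat m V"
  shows "unitary_mat (n + m) (four_block_mat U (0\<^sub>m n m) (0\<^sub>m m n) V)"
  using unitary_matD[OF assms(1)] unitary_matD[OF assms(2)]
  by (simp add: unitary_mat_def cadj_four_block_mat[of _ n n _ m _ m]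
    mult_four_block_diag[of _ n n _ m m])

lemma unitary_mat_normalize_corthogonal:
  assumes ws: "set ws \<subseteq> carrier_vec n" "corthogonal ws" "length ws = n"
  obtains W :: "complex mat" where "unitary_mat n W" "\<And>i. i < n \<Longrightarrow> \<exists>c. col W i = c \<cdot>\<^sub>v (ws ! i)"
proof -
  define c where "c i = 1 / complex_of_real (sqrt (Re (ws ! i \<bullet>c ws ! i)))" for i
  define W where "W = mat n n (\<lambda>(k,i). c i * ws ! i $ k)"
  have ws_nth: "ws ! i \<in> carrier_vec n" if "i < n" for i using ws that by auto
  have W: "W \<in> carrier_mat n n" by (simp add: W_def)
  have norm: "c i * cnj (c i) * (ws ! i \<bullet>c ws ! i) = 1" if "i < n" for i
  proof -
    have "ws ! i \<bullet>c ws ! i > 0"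
      using corthogonalD[OF ws(2), of i i] conjugate_square_greater_0_vec[OF ws_nth[OF that]] ws(3) that
      by (metis conjugate_square_eq_0_vec ws_nth)
    then obtain r where "ws ! i \<bullet>c ws ! i = complex_of_real r" "0 < r"
      by (metis complex_eq_iff Re_complex_of_real Im_complex_of_real less_complex_def zero_complex.sel)
    thus ?thesis by (simp add: c_def flip: of_real_mult)
  qed
  have "cadj W * W = 1\<^sub>m n"
  proof (rule eq_matI)
    fix i j assume "i < dim_row (1\<^sub>m n)" "j < dim_col (1\<^sub>m n)"
    hence ij: "i < n" "j < n" by auto
    have "(cadj W * W) $$ (i,j) = cnj (c i) * c j * (ws ! j \<bullet>c ws ! i)"
      using W ij ws_nth[OF ij(1)] ws_nth[OF ij(2)]
      by (simp add: index_mult_mat_sum del: index_mult_mat(1))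
         (simp add: W_def scalar_prod_def sum_distrib_left lessThan_atLeast0 mult_ac)
    also have "\<dots> = (1\<^sub>m n) $$ (i,j)"
      using ij norm[of i] corthogonalD[OF ws(2), of j i] ws(3) by (cases "i = j") (auto simp: mult_ac)
    finally show "(cadj W * W) $$ (i,j) = (1\<^sub>m n) $$ (i,j)" .
  qed (use W in auto)
  moreover have "col W i = c i \<cdot>\<^sub>v (ws ! i)" if "i < n" for i
    by (rule eq_vecI) (use that ws_nth[OF that] in \<open>auto simp: W_def\<close>)
  ultimately show ?thesis using that W by (auto simp: unitary_mat_def)
qed

lemma unitary_mat_completion:
  fixes v :: "complex vec"
  assumes v: "v \<in> carrier_vec n" "v \<noteq> 0\<^sub>v n"
  obtains W c where "unitary_mat n W" "col W 0 = c \<cdot>\<^sub>v v"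
proof -
  interpret cof_vec_space n "TYPE(complex)" .
  define b where "b = basis_completion v"
  define ws where "ws = gram_schmidt n b"
  note b = basis_completion[OF v, folded b_def]
  have ws: "set ws \<subseteq> carrier_vec n" "corthogonal ws" "length ws = n"
    using gram_schmidt_result[OF b(2,4,5) ws_def] b(6) by auto
  have n_pos: "0 < n" using v by (cases n) auto
  then obtain vs where "b = v # vs" using b(6,7) by (cases b) auto
  hence "hd ws = v" unfolding ws_def using gram_schmidt_hd[OF v(1)] by simp
  hence "ws ! 0 = v" using ws(3) n_pos by (metis hd_conv_nth list.size(3) less_irrefl)
  thus ?thesis using unitary_mat_normalize_corthogonal[OF ws] n_pos that by metis
qed

abbreviation real_diag :: "nat \<Rightarrow> (nat \<Rightarrow> real) \<Rightarrow> complex mat" where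
  "real_diag n l \<equiv> mat_diag n (\<lambda>i. complex_of_real (l i))"

lemma dim_mat_diag [simp]: "dim_row (mat_diag n f) = n" "dim_col (mat_diag n f) = n"
  by (simp_all add: mat_diag_def)

lemma cadj_real_diag [simp]: "cadj (real_diag n l) = real_diag n l"
  by (rule eq_matI) (auto simp: mat_diag_def)

definition spectral_decomp :: "nat \<Rightarrow> complex mat \<Rightarrow> complex mat \<Rightarrow> (nat \<Rightarrow> real) \<Rightarrow> bool" where
  "spectral_decomp n A U l \<longleftrightarrow> unitary_mat n U \<and> A = U * real_diag n l * cadj U"

lemma spectral_decompD:
  assumes "spectral_decomp n A U l"
  shows "unitary_mat n U" "A \<in> carrier_mat n n" "A = U * (real_diag n l * cadj U)"
    "A * U = U * real_diag n l" "cadj U * A = real_diag n l * cadj U"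
proof -
  show u: "unitary_mat n U" using assms by (auto simp: spectral_decomp_def)
  note U = unitary_matD[OF u]
  show A: "A = U * (real_diag n l * cadj U)"
    using assms U by (simp add: spectral_decomp_def mult_mat_assoc)
  show "A \<in> carrier_mat n n" unfolding A carrier_mat_def using U by simp
  show "A * U = U * real_diag n l" "cadj U * A = real_diag n l * cadj U"
    unfolding A using U by (simp_all add: mult_mat_assoc unitary_mat_cancel[OF u])
qed

lemma spectral_decomp_unitary_conj:
  assumes A: "spectral_decomp n A U l" and D: "unitary_mat n D"
  shows "spectral_decomp n (D * A * cadj D) (D * U) l"
proof -
  note U = spectral_decompD(1)[OF A]
  have "D * A * cadj D = D * U * real_diag n l * cadj (D * U)"
    unfolding spectral_decompD(3)[OF A]
    using unitary_matD(2,3)[OF D] unitary_matD(2,3)[OF U] by (simp add: cadj_mult mult_mat_assoc)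
  thus ?thesis using unitary_mat_mult[OF D U] by (simp add: spectral_decomp_def)
qed

lemma spectral_decomp_real_diag: "spectral_decomp n (real_diag n l) (1\<^sub>m n) l"
  unfolding spectral_decomp_def cadj_one left_mult_one_mat[OF mat_diag_dim]
    right_mult_one_mat[OF mat_diag_dim]
  by (simp add: unitary_mat_one)

lemma spectral_decomp_four_block:
  assumes "spectral_decomp n A U l" "spectral_decomp m B V k"
  shows "spectral_decomp (n + m) (four_block_mat A (0\<^sub>m n m) (0\<^sub>m m n) B)
    (four_block_mat U (0\<^sub>m n m) (0\<^sub>m m n) V) (\<lambda>i. if i < n then l i else k (i - n))"
proof -
  note U = spectral_decompD(1)[OF assms(1)] and V = spectral_decompD(1)[OF assms(2)]
  have "real_diag (n + m) (\<lambda>i. if i < n then l i else k (i - n))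
      = four_block_mat (real_diag n l) (0\<^sub>m n m) (0\<^sub>m m n) (real_diag m k)"
    by (rule eq_matI) (auto simp: mat_diag_def)
  thus ?thesis
    using assms unitary_mat_four_block[OF U V] unitary_matD(1)[OF U] unitary_matD(1)[OF V]
    by (simp add: spectral_decomp_def cadj_four_block_mat[of _ n n _ m _ m]
        mult_four_block_diag[of _ n n _ m m] mult_carrier_mat[of _ n n] mult_carrier_mat[of _ m m])
qed

lemma unitary_conj_first_column:
  assumes A: "A \<in> carrier_mat (Suc n) (Suc n)"
  obtains W a where "unitary_mat (Suc n) W" "col (cadj W * A * W) 0 = a \<cdot>\<^sub>v unit_vec (Suc n) 0"
proof -
  let ?N = "Suc n"
  obtain a as where "char_poly A = (\<Prod>a\<leftarrow>a # as. [:- a, 1:])"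
    using char_poly_factorized[OF A] by (metis length_Suc_conv)
  hence "eigenvalue A a" by (simp add: eigenvalue_root_char_poly[OF A])
  then obtain v where v: "v \<in> carrier_vec ?N" "v \<noteq> 0\<^sub>v ?N" "A *\<^sub>v v = a \<cdot>\<^sub>v v"
    unfolding eigenvalue_def eigenvector_def using A by auto
  obtain W c where W: "unitary_mat ?N W" and col: "col W 0 = c \<cdot>\<^sub>v v"
    using unitary_mat_completion[OF v(1,2)] by blast
  note dims = carrier_matD[OF A] unitary_matD(2,3)[OF W]
  have "col (cadj W * A * W) 0 = cadj W *\<^sub>v (A *\<^sub>v col W 0)"
    using dims A unitary_matD(1)[OF W] mult_carrier_mat[OF A unitary_matD(1)[OF W]]
    by (simp add: mult_mat_assoc col_mult2[of _ ?N ?N _ ?N] del: col_mult)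
  also have "A *\<^sub>v col W 0 = a \<cdot>\<^sub>v col W 0"
    unfolding col using v by (simp add: mult_mat_vec[OF A v(1)] smult_smult_assoc mult.commute)
  also have "cadj W *\<^sub>v (a \<cdot>\<^sub>v col W 0) = a \<cdot>\<^sub>v col (cadj W * W) 0"
    using unitary_matD(1)[OF W] mult_mat_vec[of "cadj W" ?N ?N "col W 0" a]
      carrier_vecI[of "col W 0" ?N] dims
    by (simp add: col_mult2[of _ ?N ?N _ ?N] del: col_mult)
  finally show ?thesis using that[OF W, of a] by (simp add: unitary_matD(4)[OF W])
qed

lemma hermitian_deflation:
  assumes A: "A \<in> carrier_mat (Suc n) (Suc n)" and herm: "cadj A = A"
  obtains W e B where "unitary_mat (Suc n) W" "B \<in> carrier_mat n n" "cadj B = B"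
    "cadj W * A * W = four_block_mat (real_diag 1 (\<lambda>_. e)) (0\<^sub>m 1 n) (0\<^sub>m n 1) B"
proof -
  let ?N = "Suc n"
  obtain W a where W: "unitary_mat ?N W" and col: "col (cadj W * A * W) 0 = a \<cdot>\<^sub>v unit_vec ?N 0"
    by (rule unitary_conj_first_column[OF A])
  note dims = carrier_matD[OF A] unitary_matD(2,3)[OF W]
  define C where "C = cadj W * A * W"
  have C: "C \<in> carrier_mat ?N ?N" using dims by (intro carrier_matI) (simp_all add: C_def)
  have hermitian_C: "cadj C = C" using dims by (simp add: C_def herm cadj_mult mult_mat_assoc)
  have C_index_cnj: "C $$ (i,j) = cnj (C $$ (j,i))" if "i < ?N" "j < ?N" for i j
    using arg_cong[OF hermitian_C, of "\<lambda>B. B $$ (i,j)"] that C by simp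
  have first_column: "C $$ (i,0) = (if i = 0 then a else 0)" if "i < ?N" for i
    using that C col[folded C_def] index_col[of i C 0] by (cases "i = 0") simp_all
  have a_real: "a = of_real (Re a)"
    using C_index_cnj[of 0 0] first_column[of 0] by (auto simp: complex_eq_iff)
  define B where "B = mat n n (\<lambda>(i,j). C $$ (Suc i, Suc j))"
  have B: "B \<in> carrier_mat n n" by (simp add: B_def)
  have hermitian_B: "cadj B = B" by (rule eq_matI) (auto simp: B_def C_index_cnj[symmetric])
  have "C = four_block_mat (real_diag 1 (\<lambda>_. Re a)) (0\<^sub>m 1 n) (0\<^sub>m n 1) B" (is "_ = ?D")
  proof (rule eq_matI)
    fix i j assume "i < dim_row ?D" "j < dim_col ?D"
    hence "i < ?N" "j < ?N" by (auto simp: B_def)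
    thus "C $$ (i,j) = ?D $$ (i,j)"
      using first_column[of i] first_column[of j] C_index_cnj[of i j] a_real
      by (cases i; cases j) (auto simp: B_def mat_diag_def)
  qed (use C in \<open>auto simp: B_def\<close>)
  thus ?thesis using that[OF W B hermitian_B] by (simp only: C_def)
qed

theorem hermitian_spectral_decomp:
  assumes "A \<in> carrier_mat n n" "cadj A = A"
  shows "\<exists>U l. spectral_decomp n A U l"
  using assms
proof (induction n arbitrary: A)
  case 0
  hence "A = real_diag 0 (\<lambda>_. 0)" by (intro eq_matI) (auto simp: mat_diag_def)
  thus ?case using spectral_decomp_real_diag[of 0 "\<lambda>_. 0"] by blast
next
  case (Suc n)
  obtain W e B where W: "unitary_mat (Suc n) W" and B: "B \<in> carrier_mat n n" "cadj B = B"
    and WAW: "cadj W * A * W = four_block_mat (real_diag 1 (\<lambda>_. e)) (0\<^sub>m 1 n) (0\<^sub>m n 1) B"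
    by (rule hermitian_deflation[OF Suc.prems])
  obtain V k where "spectral_decomp n B V k" using Suc.IH[OF B] by blast
  from spectral_decomp_four_block[OF spectral_decomp_real_diag[of 1 "\<lambda>_. e"] this]
  obtain U l where "spectral_decomp (Suc n) (cadj W * A * W) U l"
    unfolding WAW plus_1_eq_Suc by blast
  from spectral_decomp_unitary_conj[OF this W]
  have "spectral_decomp (Suc n) (W * (cadj W * A * W) * cadj W) (W * U) l" .
  moreover have "W * (cadj W * A * W) * cadj W = A"
    using unitary_matD[OF W] Suc.prems(1) by (simp add: mult_mat_assoc unitary_mat_cancel[OF W])
  ultimately show ?case by metis
qed

definition born_prob :: "complex mat \<Rightarrow> complex mat \<Rightarrow> nat \<Rightarrow> real" where
  "born_prob V A j = Re ((cadj V * A * V) $$ (j,j))"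

lemma born_prob_spectral_decomp:
  assumes A: "spectral_decomp n A U l" and V: "V \<in> carrier_mat n n" and j: "j < n"
  shows "born_prob V A j = (\<Sum>i<n. (cmod ((cadj V * U) $$ (j,i)))\<^sup>2 * l i)"
proof -
  define \<Omega> where "\<Omega> = cadj V * U"
  note dims = unitary_matD(2,3)[OF spectral_decompD(1)[OF A]] carrier_matD[OF V]
  have \<Omega>: "\<Omega> \<in> carrier_mat n n" using dims by (intro carrier_matI) (simp_all add: \<Omega>_def)
  have "cadj V * A * V = (\<Omega> * real_diag n l) * cadj \<Omega>"
    unfolding spectral_decompD(3)[OF A] \<Omega>_def using dims by (simp add: cadj_mult mult_mat_assoc)
  hence "(cadj V * A * V) $$ (j,j) = (\<Sum>i<n. of_real ((cmod (\<Omega> $$ (j,i)))\<^sup>2 * l i))"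
    using \<Omega> j unfolding of_real_mult complex_of_real_cmod_sq mat_diag_mult_right[OF \<Omega>]
    by (simp add: index_mult_mat_sum mult_ac del: index_mult_mat(1))
  thus ?thesis by (simp add: born_prob_def \<Omega>_def)
qed

lemma born_prob_eigenbasis:
  assumes "spectral_decomp n A U l" "j < n"
  shows "born_prob U A j = l j"
proof -
  note U = unitary_matD[OF spectral_decompD(1)[OF assms(1)]]
  have "born_prob U A j = (\<Sum>i<n. if i = j then l i else 0)"
    unfolding born_prob_spectral_decomp[OF assms(1) U(1) assms(2)]
    by (rule sum.cong) (use assms(2) U(4) in auto)
  thus ?thesis using assms(2) by simp
qed

lemma born_prob_sum:
  assumes "V \<in> carrier_mat n n" "A \<in> carrier_mat n n" "j < n"
  shows "born_prob V A j = Re (\<Sum>a<n. \<Sum>b<n. cnj (V $$ (a,j)) * A $$ (a,b) * V $$ (b,j))"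
  using assms unfolding born_prob_def
  by (subst sum.swap) (simp add: index_mult_mat_sum sum_distrib_right del: index_mult_mat(1))

definition psd_mat :: "nat \<Rightarrow> complex mat \<Rightarrow> bool" where
  "psd_mat n A \<longleftrightarrow> A \<in> carrier_mat n n \<and> cadj A = A \<and> (\<forall>V\<in>carrier_mat n n. \<forall>j<n. 0 \<le> born_prob V A j)"

lemma psd_mat_spectral_decomp:
  assumes "psd_mat n A"
  obtains U l where "spectral_decomp n A U l" "\<And>i. i < n \<Longrightarrow> 0 \<le> l i"
proof -
  obtain U l where Ul: "spectral_decomp n A U l"
    using assms hermitian_spectral_decomp[of A n] by (auto simp: psd_mat_def)
  moreover have "0 \<le> l i" if "i < n" for i
    using assms that unitary_matD(1)[OF spectral_decompD(1)[OF Ul]] born_prob_eigenbasis[OF Ul that]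
    by (metis psd_mat_def)
  ultimately show ?thesis using that by blast
qed

lemma psd_mat_gram:
  assumes M: "M \<in> carrier_mat k n"
  shows "psd_mat n (cadj M * M)"
  unfolding psd_mat_def
proof (intro conjI ballI allI impI)
  fix V :: "complex mat" and j assume V: "V \<in> carrier_mat n n" and j: "j < n"
  have "cadj V * (cadj M * M) * V = cadj (M * V) * (M * V)"
    using M V by (simp add: cadj_mult mult_mat_assoc)
  also have "\<dots> $$ (j,j) = (\<Sum>l<k. of_real ((cmod ((M * V) $$ (l,j)))\<^sup>2))"
    using M V j unfolding complex_of_real_cmod_sq
    by (simp add: index_mult_mat_sum[of _ "cadj (M * V)"] del: index_mult_mat(1))
  finally show "0 \<le> born_prob V (cadj M * M) j"
    by (simp add: born_prob_def sum_nonneg del: index_mult_mat)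
qed (use M in \<open>simp_all add: cadj_gram_mat mult_carrier_mat[of _ n k]\<close>)

section \<open>Von Neumann entropy\<close>

lemma order_linear_factors:
  fixes as :: "'a::idom list"
  shows "Polynomial.order e (\<Prod>a\<leftarrow>as. [:- a, 1:]) = count_list as e"
proof (induction as)
  case (Cons a as)
  have "[:- a, 1:] * (\<Prod>a\<leftarrow>as. [:- a, 1:]) \<noteq> 0"
    by (auto simp: prod_list_zero_iff simp del: mult_pCons_left)
  moreover have "Polynomial.order e [:- a, 1:] = (if a = e then 1 else 0)"
    using order_power_n_n[of e 1] by (auto intro: order_0I)
  ultimately show ?case using Cons by (simp add: order_mult del: mult_pCons_left)
qed simp

lemma sum_list_map_eq_sum_of_nat_count:
  fixes f :: "'a \<Rightarrow> 'b::semiring_1"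
  shows "(\<Sum>a\<leftarrow>as. f a) = (\<Sum>e\<in>set as. of_nat (count_list as e) * f e)"
proof -
  have "(\<Sum>a\<leftarrow>as. f a) = (\<Sum>e\<in>S. of_nat (count_list as e) * f e)" if "finite S" "set as \<subseteq> S" for S
    using that(2)
  proof (induction as)
    case (Cons a as)
    have "(\<Sum>e\<in>S. of_nat (count_list (a # as) e) * f e)
        = (\<Sum>e\<in>S. (if e = a then f e else 0) + of_nat (count_list as e) * f e)"
      by (rule sum.cong) (auto simp: algebra_simps)
    thus ?case using Cons \<open>finite S\<close> by (simp add: sum.distrib)
  qed simp
  thus ?thesis by blast
qed

lemma vn_entropy_linear_factors:
  assumes "char_poly A = (\<Prod>a\<leftarrow>as. [:- a, 1:])"
  shows "vn_entropy A = (\<Sum>a\<leftarrow>as. eta (Re a))"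
proof -
  have "{e. poly (char_poly A) e = 0} = set as"
    unfolding assms by (auto simp: poly_prod_list prod_list_zero_iff)
  thus ?thesis
    by (simp add: vn_entropy_def assms order_linear_factors sum_list_map_eq_sum_of_nat_count)
qed

lemma vn_entropy_similar: "similar_mat A B \<Longrightarrow> vn_entropy A = vn_entropy B"
  using char_poly_similar[of A B] by (simp add: vn_entropy_def)

lemma vn_entropy_real_diag: "vn_entropy (real_diag n l) = (\<Sum>i<n. eta (l i))"
proof -
  have "char_poly (real_diag n l) = (\<Prod>a\<leftarrow>diag_mat (real_diag n l). [:- a, 1:])"
    by (rule char_poly_upper_triangular[of _ n]) (auto simp: mat_diag_def)
  hence "vn_entropy (real_diag n l) = (\<Sum>a\<leftarrow>diag_mat (real_diag n l). eta (Re a))"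
    by (rule vn_entropy_linear_factors)
  also have "diag_mat (real_diag n l) = map (\<lambda>i. complex_of_real (l i)) [0..<n]"
    unfolding diag_mat_def by (rule map_cong) (auto simp: mat_diag_def)
  finally show ?thesis by (simp add: o_def interv_sum_list_conv_sum_set_nat lessThan_atLeast0)
qed

lemma vn_entropy_spectral_decomp:
  assumes "spectral_decomp n A U l"
  shows "vn_entropy A = (\<Sum>i<n. eta (l i))"
proof -
  note U = unitary_matD[OF spectral_decompD(1)[OF assms]]
  have "similar_mat A (real_diag n l)"
    using assms U spectral_decompD(2)[OF assms]
    by (intro similar_matI[of _ _ U "cadj U" n]) (auto simp: spectral_decomp_def)
  thus ?thesis by (simp add: vn_entropy_similar vn_entropy_real_diag)
qed

lemma eta_eq: "0 \<le> x \<Longrightarrow> eta x = - (x * log 2 x)"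
  by (auto simp: eta_def)

lemma vn_entropy_zero: "vn_entropy (0\<^sub>m n n) = 0"
proof -
  have "0\<^sub>m n n = real_diag n (\<lambda>_. 0)" by (rule eq_matI) (auto simp: mat_diag_def)
  thus ?thesis using vn_entropy_real_diag[of n "\<lambda>_. 0"] by (simp add: eta_def)
qed

lemma vn_entropy_four_block_triangular:
  assumes A: "A \<in> carrier_mat n n" and D: "D \<in> carrier_mat m m"
  shows "B \<in> carrier_mat n m \<Longrightarrow> vn_entropy (four_block_mat A B (0\<^sub>m m n) D) = vn_entropy A + vn_entropy D"
    and "C \<in> carrier_mat m n \<Longrightarrow> vn_entropy (four_block_mat A (0\<^sub>m n m) C D) = vn_entropy A + vn_entropy D"
proof -
  obtain as ds where factors: "char_poly A = (\<Prod>a\<leftarrow>as. [:- a, 1:])" "char_poly D = (\<Prod>a\<leftarrow>ds. [:- a, 1:])"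
    using char_poly_factorized[OF A] char_poly_factorized[OF D] by blast
  have add: "vn_entropy M = vn_entropy A + vn_entropy D"
    if "char_poly M = char_poly A * char_poly D" for M
    using vn_entropy_linear_factors[of M "as @ ds"] that factors
    by (simp add: vn_entropy_linear_factors)
  show "vn_entropy (four_block_mat A B (0\<^sub>m m n) D) = vn_entropy A + vn_entropy D"
    if "B \<in> carrier_mat n m"
    using that factors A D by (intro add char_poly_0_block[OF refl]) auto
  show "vn_entropy (four_block_mat A (0\<^sub>m n m) C D) = vn_entropy A + vn_entropy D"
    if "C \<in> carrier_mat m n"
    using that factors A D by (intro add char_poly_0_block'[OF refl]) auto
qed

lemma similar_mat_mult_swap:
  fixes A B :: "complex mat"
  assumes A: "A \<in> carrier_mat n m" and B: "B \<in> carrier_mat m n"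
  shows "similar_mat (four_block_mat (A * B) (0\<^sub>m n m) B (0\<^sub>m m m))
    (four_block_mat (0\<^sub>m n n) (0\<^sub>m n m) B (B * A))"
proof -
  have BA: "B * A \<in> carrier_mat m m" and AB: "A * B \<in> carrier_mat n n"
    and BAB: "A * B * A = A * (B * A)" and neg: "A + - A = 0\<^sub>m n m" "- A + A = 0\<^sub>m n m"
      "- (A * (B * A)) + A * (B * A) = 0\<^sub>m n m" "- (B * A) + B * A = 0\<^sub>m m m"
      "- 0\<^sub>m m m = (0\<^sub>m m m :: complex mat)"
    using A B by (auto simp: mult_mat_assoc intro!: eq_matI)
  define P where "P = four_block_mat (1\<^sub>m n) A (0\<^sub>m m n) (1\<^sub>m m)"
  define Q where "Q = four_block_mat (1\<^sub>m n) (- A) (0\<^sub>m m n) (1\<^sub>m m)"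
  have "P * Q = 1\<^sub>m (n + m)" "Q * P = 1\<^sub>m (n + m)"
    unfolding P_def Q_def using A neg
    by (simp_all add: mult_four_block_mat[of _ n n _ m _ m _ _ n _ m])
  moreover have "four_block_mat (A * B) (0\<^sub>m n m) B (0\<^sub>m m m)
      = P * four_block_mat (0\<^sub>m n n) (0\<^sub>m n m) B (B * A) * Q"
    unfolding P_def Q_def using A B AB BA BAB
    by (simp add: neg mult_four_block_mat[of _ n n _ m _ m _ _ n _ m])
  moreover have "{four_block_mat (A * B) (0\<^sub>m n m) B (0\<^sub>m m m),
      four_block_mat (0\<^sub>m n n) (0\<^sub>m n m) B (B * A), P, Q} \<subseteq> carrier_mat (n + m) (n + m)"
    using A B AB BA by (auto simp: P_def Q_def)
  ultimately show ?thesis by (intro similar_matI)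
qed

lemma vn_entropy_mult_swap:
  assumes A: "A \<in> carrier_mat n m" and B: "B \<in> carrier_mat m n"
  shows "vn_entropy (A * B) = vn_entropy (B * A)"
proof -
  have "vn_entropy (A * B) = vn_entropy (four_block_mat (A * B) (0\<^sub>m n m) B (0\<^sub>m m m))"
    using A B by (subst vn_entropy_four_block_triangular[of _ n _ m]) (auto simp: vn_entropy_zero)
  also have "\<dots> = vn_entropy (four_block_mat (0\<^sub>m n n) (0\<^sub>m n m) B (B * A))"
    by (rule vn_entropy_similar[OF similar_mat_mult_swap[OF A B]])
  also have "\<dots> = vn_entropy (B * A)"
    using A B by (subst vn_entropy_four_block_triangular[of _ n _ m]) (auto simp: vn_entropy_zero)
  finally show ?thesis .
qed

lemma det_2x2:
  assumes A: "A \<in> carrier_mat 2 2"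
  shows "det A = A $$ (0,0) * A $$ (1,1) - A $$ (1,0) * A $$ (0,1)"
proof -
  have minor: "mat_delete A i 0 \<in> carrier_mat 1 1" for i
    using mat_delete_carrier[OF A, of i 0] by simp
  have "det A = (\<Sum>i<2. A $$ (i,0) * cofactor A i 0)"
    by (rule laplace_expansion_column[OF A]) simp
  thus ?thesis
    unfolding sum_lessThan_2 cofactor_def det_single[OF minor] using A by (simp add: mat_delete_def)
qed

lemma vn_entropy_2x2:
  assumes A: "A \<in> carrier_mat 2 2"
    and trace: "A $$ (0,0) + A $$ (1,1) = complex_of_real (x + y)"
    and det: "A $$ (0,0) * A $$ (1,1) - A $$ (1,0) * A $$ (0,1) = complex_of_real (x * y)"
  shows "vn_entropy A = eta x + eta y"
proof -
  have "char_poly A = [:A $$ (0,0) * A $$ (1,1) - A $$ (1,0) * A $$ (0,1),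
    - (A $$ (0,0) + A $$ (1,1)), 1:]"
    using A unfolding char_poly_def
    by (subst det_2x2) (simp_all add: char_poly_matrix_def algebra_simps)
  also have "\<dots> = (\<Prod>a\<leftarrow>[complex_of_real x, complex_of_real y]. [:- a, 1:])"
    unfolding trace det by simp
  finally have "char_poly A = (\<Prod>a\<leftarrow>[complex_of_real x, complex_of_real y]. [:- a, 1:])" .
  from vn_entropy_linear_factors[OF this] show ?thesis by simp
qed

section \<open>Traces\<close>

lemma index_mult_mat_diag [simp]:
  "i < dim_row A \<Longrightarrow> j < n \<Longrightarrow> dim_col A = n \<Longrightarrow> (A * mat_diag n f) $$ (i,j) = A $$ (i,j) * f j"
  by (subst mat_diag_mult_right[of _ "dim_row A"]) auto

lemma index_mat_diag_mult [simp]: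
  "i < n \<Longrightarrow> j < dim_col A \<Longrightarrow> dim_row A = n \<Longrightarrow> (mat_diag n f * A) $$ (i,j) = f i * A $$ (i,j)"
  by (subst mat_diag_mult_left[of _ _ "dim_col A"]) auto

lemma mtrace_mult:
  assumes "dim_row A = dim_col B" "dim_col A = dim_row B"
  shows "mtrace (A * B) = (\<Sum>i<dim_row A. \<Sum>j<dim_col A. A $$ (i,j) * B $$ (j,i))"
  using assms by (simp add: mtrace_def index_mult_mat_sum del: index_mult_mat(1))

lemma mtrace_mult_comm:
  assumes "dim_row A = dim_col B" "dim_col A = dim_row B"
  shows "mtrace (A * B) = mtrace (B * A)"
  unfolding mtrace_mult[OF assms] mtrace_mult[OF assms(2)[symmetric] assms(1)[symmetric]]
  by (subst sum.swap) (simp add: assms mult.commute)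

lemma mtrace_cadj_mult:
  assumes "X \<in> carrier_mat n m" "Z \<in> carrier_mat n m"
  shows "mtrace (cadj X * Z) = (\<Sum>i<m. \<Sum>j<n. cnj (X $$ (j,i)) * Z $$ (j,i))"
  using assms by (simp add: mtrace_mult)

lemma mtrace_unitary_conj:
  assumes "unitary_mat n U" "B \<in> carrier_mat n n"
  shows "mtrace (U * B * cadj U) = mtrace B"
  using assms unitary_matD[OF assms(1)]
  by (subst mtrace_mult_comm) (auto simp: unitary_mat_cancel)

lemma mtrace_cadj_mult_unitary:
  assumes "unitary_mat n U" "unitary_mat n V" "Y \<in> carrier_mat n n" "Z \<in> carrier_mat n n"
  shows "mtrace (cadj (cadj V * Y * U) * (cadj V * Z * U)) = mtrace (cadj Y * Z)"
proof -
  have "cadj (cadj V * Y * U) * (cadj V * Z * U) = cadj U * (cadj Y * Z) * cadj (cadj U)"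
    using assms unitary_matD(2,3)[OF assms(1)] unitary_matD(2,3)[OF assms(2)]
    by (simp add: cadj_mult mult_mat_assoc unitary_mat_cancel[OF assms(2)])
  thus ?thesis
    using assms mtrace_unitary_conj[OF unitary_mat_cadj[OF assms(1)], of "cadj Y * Z"]
    by (simp add: mult_carrier_mat[of _ n n])
qed

lemma mtrace_spectral_decomp:
  assumes "spectral_decomp n A U l"
  shows "mtrace A = complex_of_real (\<Sum>i<n. l i)"
proof -
  have "mtrace A = mtrace (real_diag n l)"
    using assms by (auto simp: spectral_decomp_def intro!: mtrace_unitary_conj)
  thus ?thesis by (simp add: mtrace_def mat_diag_def)
qed

section \<open>Relative entropy as an integral\<close>

lemma relative_entropy_antiderivative:
  fixes l m t :: real
  assumes "0 \<le> l" "0 < m" "0 \<le> t"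
  shows "((\<lambda>t. l * ln (l + (m - l) / (1 + t)) - (m - l) / (1 + t)) has_real_derivative
      (l - m)\<^sup>2 / (m + t * l) / (1 + t)\<^sup>2) (at t)"
proof -
  have pos: "0 < m + t * l" "0 < 1 + t" using assms by (auto intro: add_pos_nonneg)
  have arg: "l + (m - l) / (1 + t) = (m + t * l) / (1 + t)" using pos by (simp add: field_simps)
  hence "0 < l + (m - l) / (1 + t)" using pos by simp
  hence "((\<lambda>t. l * ln (l + (m - l) / (1 + t)) - (m - l) / (1 + t)) has_real_derivative
      l * ((- (m - l) / (1 + t)\<^sup>2) / (l + (m - l) / (1 + t))) - (- (m - l) / (1 + t)\<^sup>2)) (at t)"
    using pos by (auto intro!: derivative_eq_intros simp: power2_eq_square mult_ac)
  also have "l * ((- (m - l) / (1 + t)\<^sup>2) / (l + (m - l) / (1 + t))) - (- (m - l) / (1 + t)\<^sup>2)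
      = (m - l) / (1 + t)\<^sup>2 * (1 - l * (1 + t) / (m + t * l))"
    unfolding arg using pos by (simp add: divide_simps) (simp add: algebra_simps)
  also have "1 - l * (1 + t) / (m + t * l) = (m - l) / (m + t * l)"
    using pos by (simp add: divide_simps) (simp add: algebra_simps)
  also have "(m - l) / (1 + t)\<^sup>2 * ((m - l) / (m + t * l)) = (l - m)\<^sup>2 / (m + t * l) / (1 + t)\<^sup>2"
    by (simp add: power2_eq_square algebra_simps)
  finally show ?thesis .
qed

lemma relative_entropy_antiderivative_limit:
  fixes l m :: real
  assumes "0 \<le> l"
  shows "((\<lambda>t. l * ln (l + (m - l) / (1 + t)) - (m - l) / (1 + t)) \<longlongrightarrow> l * ln l) at_top"
proof -
  have vanishing: "((\<lambda>t::real. (m - l) / (1 + t)) \<longlongrightarrow> 0) at_top"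
    by (intro tendsto_divide_0[OF tendsto_const] filterlim_at_top_imp_at_infinity
        filterlim_tendsto_add_at_top[OF tendsto_const] filterlim_ident)
  show ?thesis
  proof (cases "l = 0")
    case True
    thus ?thesis using tendsto_minus[OF vanishing] by simp
  next
    case False
    hence "((\<lambda>t. l * ln (l + (m - l) / (1 + t)) - (m - l) / (1 + t)) \<longlongrightarrow> l * ln (l + 0) - 0) at_top"
      by (intro tendsto_intros vanishing) auto
    thus ?thesis by simp
  qed
qed

lemma relative_entropy_kernel_has_integral:
  fixes l m :: real
  assumes "0 \<le> l" "0 < m"
  shows "((\<lambda>t. (l - m)\<^sup>2 / (m + t * l) / (1 + t)\<^sup>2) has_integral (l * ln l - l * ln m - l + m)) {0..}"
proof -
  define F where "F t = l * ln (l + (m - l) / (1 + t)) - (m - l) / (1 + t)" for t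
  let ?f = "\<lambda>t. (l - m)\<^sup>2 / (m + t * l) / (1 + t)\<^sup>2"
  have FTC: "(?f has_integral F y - F 0) {0..y}" if "0 \<le> y" for y
    unfolding F_def using relative_entropy_antiderivative[OF assms]
    by (intro fundamental_theorem_of_calculus[OF that])
       (auto simp: has_real_derivative_iff_has_vector_derivative intro: has_vector_derivative_at_within)
  have "((\<lambda>y. F y - F 0) \<longlongrightarrow> l * ln l - F 0) at_top"
    unfolding F_def by (intro tendsto_diff tendsto_const relative_entropy_antiderivative_limit assms)
  moreover have "eventually (\<lambda>y. F y - F 0 = integral {0..y} ?f) at_top"
    using FTC by (intro eventually_at_top_linorderI[of 0] integral_unique[symmetric])
  ultimately have "((\<lambda>y. integral {0..y} ?f) \<longlongrightarrow> l * ln l - F 0) at_top"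
    by (rule Lim_transform_eventually)
  moreover have "?f integrable_on {0..y}" for y
    using FTC[of y] by (cases "0 \<le> y") auto
  moreover have "0 \<le> ?f t" if "0 \<le> t" for t using that assms by simp
  ultimately have "(?f has_integral (l * ln l - F 0)) {0..}"
    by (intro has_integral_to_inf) auto
  thus ?thesis by (simp add: F_def algebra_simps)
qed

definition chi_div :: "real \<Rightarrow> nat \<Rightarrow> complex mat \<Rightarrow> (nat \<Rightarrow> real) \<Rightarrow> complex mat \<Rightarrow> (nat \<Rightarrow> real) \<Rightarrow> real"
  where
  "chi_div t n U l V m =
    (\<Sum>i<n. \<Sum>j<n. (cmod ((cadj V * U) $$ (j,i)))\<^sup>2 * ((l i - m j)\<^sup>2 / (m j + t * l i)))"

text \<open>The relative entropy \<open>tr (\<rho> (ln \<rho> - ln \<sigma>) - \<rho> + \<sigma>)\<close> of \<open>\<rho> = U diag(l) U\<^sup>*\<close> with respect to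
  \<open>\<sigma> = V diag(m) V\<^sup>*\<close>.\<close>

definition rel_entropy :: "nat \<Rightarrow> complex mat \<Rightarrow> (nat \<Rightarrow> real) \<Rightarrow> complex mat \<Rightarrow> (nat \<Rightarrow> real) \<Rightarrow> real" where
  "rel_entropy n U l V m =
    (\<Sum>i<n. \<Sum>j<n. (cmod ((cadj V * U) $$ (j,i)))\<^sup>2 * (l i * ln (l i) - l i * ln (m j) - l i + m j))"

definition spectral_pair ::
    "nat \<Rightarrow> complex mat \<Rightarrow> complex mat \<Rightarrow> complex mat \<Rightarrow> (nat \<Rightarrow> real) \<Rightarrow> complex mat \<Rightarrow> (nat \<Rightarrow> real) \<Rightarrow> bool"
    where
  "spectral_pair n \<rho> \<sigma> U l V m \<longleftrightarrow> spectral_decomp n \<rho> U l \<and> (\<forall>i<n. 0 \<le> l i)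
    \<and> spectral_decomp n \<sigma> V m \<and> (\<forall>j<n. 0 < m j)"

lemma rel_entropy_has_integral:
  assumes "spectral_pair n \<rho> \<sigma> U l V m"
  shows "((\<lambda>t. chi_div t n U l V m / (1 + t)\<^sup>2) has_integral rel_entropy n U l V m) {0..}"
  using assms unfolding rel_entropy_def chi_div_def spectral_pair_def sum_divide_distrib
    times_divide_eq_right[symmetric]
  by (intro has_integral_sum finite_lessThan has_integral_mult_right
    relative_entropy_kernel_has_integral) auto

lemma rel_entropy_eq:
  assumes "spectral_pair n \<rho> \<sigma> U l V m"
  shows "rel_entropy n U l V m
    = - (ln 2 * vn_entropy \<rho>) - (\<Sum>j<n. ln (m j) * born_prob V \<rho> j) - Re (mtrace \<rho>) + Re (mtrace \<sigma>)"
proof -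
  have U: "spectral_decomp n \<rho> U l" and V: "spectral_decomp n \<sigma> V m" and l: "\<And>i. i < n \<Longrightarrow> 0 \<le> l i"
    using assms by (auto simp: spectral_pair_def)
  define w where "w i j = (cmod ((cadj V * U) $$ (j,i)))\<^sup>2" for i j
  have "unitary_mat n (cadj V * U)"
    by (intro unitary_mat_mult unitary_mat_cadj spectral_decompD(1)[OF U] spectral_decompD(1)[OF V])
  hence w_marginals: "(\<Sum>j<n. w i j) = 1" "(\<Sum>i<n. w i j) = 1" if "i < n" "j < n" for i j
    unfolding w_def using that by (auto intro: unitary_mat_col_norm unitary_mat_row_norm)
  have "rel_entropy n U l V m = (\<Sum>i<n. \<Sum>j<n. w i j * (l i * ln (l i)))
    - (\<Sum>i<n. \<Sum>j<n. w i j * (l i * ln (m j)))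
      - (\<Sum>i<n. \<Sum>j<n. w i j * l i) + (\<Sum>i<n. \<Sum>j<n. w i j * m j)"
    by (simp add: rel_entropy_def w_def[symmetric] sum.distrib sum_subtractf algebra_simps)
  also have "(\<Sum>i<n. \<Sum>j<n. w i j * (l i * ln (l i))) = (\<Sum>i<n. l i * ln (l i))"
    by (simp add: w_marginals flip: sum_distrib_right)
  also have "\<dots> = - (ln 2 * vn_entropy \<rho>)"
    unfolding vn_entropy_spectral_decomp[OF U] sum_distrib_left sum_negf[symmetric]
    by (rule sum.cong) (use l in \<open>auto simp: eta_eq log_def\<close>)
  also have "(\<Sum>i<n. \<Sum>j<n. w i j * l i) = Re (mtrace \<rho>)"
    by (simp add: w_marginals mtrace_spectral_decomp[OF U] flip: sum_distrib_right)
  also have "(\<Sum>i<n. \<Sum>j<n. w i j * m j) = Re (mtrace \<sigma>)"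
    by (subst sum.swap) (simp add: w_marginals mtrace_spectral_decomp[OF V] flip: sum_distrib_right)
  also have "(\<Sum>i<n. \<Sum>j<n. w i j * (l i * ln (m j))) = (\<Sum>j<n. ln (m j) * born_prob V \<rho> j)"
    using unitary_matD(1)[OF spectral_decompD(1)[OF V]]
    by (subst sum.swap) (simp add: born_prob_spectral_decomp[OF U] w_def sum_distrib_left mult_ac)
  finally show ?thesis .
qed

section \<open>Joint convexity of relative entropy\<close>

text \<open>For fixed \<open>Y\<close> this is linear in \<open>(\<rho>, \<sigma>)\<close>, and in the coordinates \<open>V\<^sup>* Y U\<close> it is a sum of
  concave quadratics whose maximum is \<open>chi_div\<close>.\<close>

definition chi_form :: "real \<Rightarrow> complex mat \<Rightarrow> complex mat \<Rightarrow> complex mat \<Rightarrow> real" where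
  "chi_form t Y \<rho> \<sigma> = Re (mtrace (cadj Y * (2 \<cdot>\<^sub>m (\<rho> - \<sigma>) - (\<sigma> * Y + complex_of_real t \<cdot>\<^sub>m (Y * \<rho>)))))"

lemma chi_form_linear:
  assumes "Y \<in> carrier_mat n n" "\<rho> \<in> carrier_mat n n" "\<sigma> \<in> carrier_mat n n"
    "\<rho>' \<in> carrier_mat n n" "\<sigma>' \<in> carrier_mat n n"
  shows "chi_form t Y (complex_of_real a \<cdot>\<^sub>m \<rho> + complex_of_real b \<cdot>\<^sub>m \<rho>')
      (complex_of_real a \<cdot>\<^sub>m \<sigma> + complex_of_real b \<cdot>\<^sub>m \<sigma>')
    = a * chi_form t Y \<rho> \<sigma> + b * chi_form t Y \<rho>' \<sigma>'"
proof -
  have entry: "chi_form t Y A B = Re (\<Sum>i<n. \<Sum>j<n. cnj (Y $$ (j,i)) * (2 * (A $$ (j,i) - B $$ (j,i))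
      - ((\<Sum>k<n. B $$ (j,k) * Y $$ (k,i)) + complex_of_real t * (\<Sum>k<n. Y $$ (j,k) * A $$ (k,i)))))"
    if "A \<in> carrier_mat n n" "B \<in> carrier_mat n n" for A B
    using that assms(1) unfolding chi_form_def
    by (subst mtrace_cadj_mult[of _ n n])
       (auto simp: index_mult_mat_sum simp del: index_mult_mat(1)
          intro!: mult_carrier_mat[of _ n n _ n])
  show ?thesis
    using assms by (simp add: entry sum.distrib sum_subtractf sum_distrib_left algebra_simps)
qed

lemma chi_form_spectral_pair:
  fixes t :: real
  assumes "spectral_pair n \<rho> \<sigma> U l V m" and Y: "Y \<in> carrier_mat n n"
  defines "X \<equiv> cadj V * Y * U" and "\<Omega> \<equiv> cadj V * U"
  shows "chi_form t Y \<rho> \<sigma> = (\<Sum>i<n. \<Sum>j<n. 2 * (l i - m j) * Re (cnj (X $$ (j,i)) * \<Omega> $$ (j,i))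
        - (m j + t * l i) * (cmod (X $$ (j,i)))\<^sup>2)"
proof -
  have \<rho>: "spectral_decomp n \<rho> U l" and \<sigma>: "spectral_decomp n \<sigma> V m"
    using assms(1) by (auto simp: spectral_pair_def)
  note U = spectral_decompD[OF \<rho>] and V = spectral_decompD[OF \<sigma>]
  note uU = unitary_matD(1-3)[OF U(1)] and uV = unitary_matD(1-3)[OF V(1)]
  define Z where "Z = 2 \<cdot>\<^sub>m (\<rho> - \<sigma>) - (\<sigma> * Y + complex_of_real t \<cdot>\<^sub>m (Y * \<rho>))"
  have Z: "Z \<in> carrier_mat n n" using U(2) V(2) Y by (intro carrier_matI) (simp_all add: Z_def)
  have X: "X \<in> carrier_mat n n" and \<Omega>: "\<Omega> \<in> carrier_mat n n"
    using uU uV Y unfolding X_def \<Omega>_def by (auto intro!: mult_carrier_mat[of _ n n])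
  have expand: "cadj V * Z * U = 2 \<cdot>\<^sub>m (cadj V * (\<rho> * U) - cadj V * \<sigma> * U)
      - (cadj V * \<sigma> * (Y * U) + complex_of_real t \<cdot>\<^sub>m (cadj V * Y * (\<rho> * U)))"
    unfolding Z_def using U(2) V(2) uU(1) uV(1) Y
    by (simp add: mult_carrier_mat[of _ n n _ n] assoc_mult_mat[of _ n n _ n _ n]
        mult_minus_distrib_mat[of _ n n _ n] minus_mult_distrib_mat[of _ n n _ _ n]
        mult_add_distrib_mat[of _ n n _ n] add_mult_distrib_mat[of _ n n _ _ n]
        mult_smult_distrib[of _ n n _ n] mult_smult_assoc_mat[of _ n n _ n]
        minus_carrier_mat[of _ n n] add_carrier_mat[of _ n n] smult_carrier_mat[of _ n n])
  have eigen: "cadj V * (\<rho> * U) = \<Omega> * real_diag n l" "cadj V * \<sigma> * U = real_diag n m * \<Omega>"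
      "cadj V * \<sigma> * (Y * U) = real_diag n m * X" "cadj V * Y * (\<rho> * U) = X * real_diag n l"
    unfolding U(4) V(5) X_def \<Omega>_def using uU(2,3) uV(2,3) Y by (simp_all add: mult_mat_assoc)
  have entry: "(cadj V * Z * U) $$ (j,i)
      = 2 * of_real (l i - m j) * \<Omega> $$ (j,i) - of_real (m j + t * l i) * X $$ (j,i)"
        if "i < n" "j < n" for i j
    unfolding expand eigen using that X \<Omega> by (simp add: algebra_simps del: index_mult_mat(1))
  have "chi_form t Y \<rho> \<sigma> = Re (mtrace (cadj X * (cadj V * Z * U)))"
    unfolding chi_form_def Z_def[symmetric] X_def
    by (simp only: mtrace_cadj_mult_unitary[OF U(1) V(1) Y Z])
  also have "\<dots> = Re (\<Sum>i<n. \<Sum>j<n. cnj (X $$ (j,i)) * (cadj V * Z * U) $$ (j,i))"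
    by (subst mtrace_cadj_mult[of _ n n]) (use X uU uV Z
      in \<open>auto intro!: mult_carrier_mat[of _ n n _ n]\<close>)
  also have "\<dots> = (\<Sum>i<n. \<Sum>j<n. 2 * (l i - m j) * Re (cnj (X $$ (j,i)) * \<Omega> $$ (j,i))
        - (m j + t * l i) * (cmod (X $$ (j,i)))\<^sup>2)"
    unfolding Re_sum
    by (intro sum.cong refl, subst entry)
       (auto simp: cmod_power2, simp add: algebra_simps power2_eq_square)
  finally show ?thesis .
qed

lemma complete_square:
  fixes x z :: complex and a c :: real
  assumes "c \<noteq> 0"
  shows "2 * a * Re (cnj x * z) - c * (cmod x)\<^sup>2
    = (cmod z)\<^sup>2 * (a\<^sup>2 / c) - (cmod (of_real c * x - of_real a * z))\<^sup>2 / c"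
  using assms by (simp add: cmod_power2) (simp add: field_simps power2_eq_square)

lemma chi_form_le_chi_div:
  assumes pair: "spectral_pair n \<rho> \<sigma> U l V m" and t: "0 \<le> t" and Y: "Y \<in> carrier_mat n n"
  shows "chi_form t Y \<rho> \<sigma> \<le> chi_div t n U l V m"
  unfolding chi_form_spectral_pair[OF pair Y] chi_div_def
proof (intro sum_mono)
  fix i j assume "i \<in> {..<n}" "j \<in> {..<n}"
  hence "0 < m j + t * l i" using pair t by (auto simp: spectral_pair_def intro!: add_pos_nonneg)
  thus "2 * (l i - m j) * Re (cnj ((cadj V * Y * U) $$ (j,i)) * (cadj V * U) $$ (j,i))
      - (m j + t * l i) * (cmod ((cadj V * Y * U) $$ (j,i)))\<^sup>2
    \<le> (cmod ((cadj V * U) $$ (j,i)))\<^sup>2 * ((l i - m j)\<^sup>2 / (m j + t * l i))"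
    by (subst complete_square) auto
qed

lemma chi_form_attains_chi_div:
  assumes pair: "spectral_pair n \<rho> \<sigma> U l V m" and t: "0 \<le> t"
  obtains Y where "Y \<in> carrier_mat n n" "chi_form t Y \<rho> \<sigma> = chi_div t n U l V m"
proof -
  have u: "unitary_mat n U" "unitary_mat n V"
    using pair by (auto simp: spectral_pair_def spectral_decomp_def)
  define X where "X = mat n n (\<lambda>(j,i). of_real ((l i - m j) / (m j + t * l i)) * (cadj V * U) $$ (j,i))"
  define Y where "Y = V * X * cadj U"
  have Y: "Y \<in> carrier_mat n n"
    using unitary_matD(1)[OF u(1)] unitary_matD(1)[OF u(2)]
    unfolding Y_def by (auto simp: X_def intro!: mult_carrier_mat[of _ n n])
  have "cadj V * Y * U = X"
    using unitary_matD[OF u(1)] unitary_matD[OF u(2)] unfolding Y_def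
    by (simp add: mult_mat_assoc unitary_mat_cancel[OF u(2)] X_def)
  moreover have "2 * (l i - m j) * Re (cnj (X $$ (j,i)) * (cadj V * U) $$ (j,i))
      - (m j + t * l i) * (cmod (X $$ (j,i)))\<^sup>2
    = (cmod ((cadj V * U) $$ (j,i)))\<^sup>2 * ((l i - m j)\<^sup>2 / (m j + t * l i))" if "i < n" "j < n" for i j
  proof -
    define a c where "a = l i - m j" and "c = m j + t * l i"
    have c: "c \<noteq> 0" using pair t that add_pos_nonneg[of "m j" "t * l i"]
      by (force simp: c_def spectral_pair_def)
    have "X $$ (j,i) = of_real (a / c) * (cadj V * U) $$ (j,i)"
      using that by (simp add: X_def a_def c_def del: index_mult_mat(1))
    hence "of_real c * X $$ (j,i) = of_real a * (cadj V * U) $$ (j,i)" using c by simp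
    thus ?thesis
      unfolding a_def[symmetric] c_def[symmetric] complete_square[OF c] by simp
  qed
  ultimately have "chi_form t Y \<rho> \<sigma> = chi_div t n U l V m"
    unfolding chi_form_spectral_pair[OF pair Y] chi_div_def by simp
  thus ?thesis using that Y by blast
qed

lemma chi_div_jointly_convex:
  assumes mixture: "spectral_pair n (complex_of_real a \<cdot>\<^sub>m \<rho>\<^sub>1 + complex_of_real b \<cdot>\<^sub>m \<rho>\<^sub>2)
      (complex_of_real a \<cdot>\<^sub>m \<sigma>\<^sub>1 + complex_of_real b \<cdot>\<^sub>m \<sigma>\<^sub>2) U l V m"
    and pairs: "spectral_pair n \<rho>\<^sub>1 \<sigma>\<^sub>1 U\<^sub>1 l\<^sub>1 V\<^sub>1 m\<^sub>1" "spectral_pair n \<rho>\<^sub>2 \<sigma>\<^sub>2 U\<^sub>2 l\<^sub>2 V\<^sub>2 m\<^sub>2"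
    and "0 \<le> a" "0 \<le> b" "0 \<le> t"
  shows "chi_div t n U l V m \<le> a * chi_div t n U\<^sub>1 l\<^sub>1 V\<^sub>1 m\<^sub>1 + b * chi_div t n U\<^sub>2 l\<^sub>2 V\<^sub>2 m\<^sub>2"
proof -
  obtain Y where Y: "Y \<in> carrier_mat n n"
    and "chi_form t Y (complex_of_real a \<cdot>\<^sub>m \<rho>\<^sub>1 + complex_of_real b \<cdot>\<^sub>m \<rho>\<^sub>2)
      (complex_of_real a \<cdot>\<^sub>m \<sigma>\<^sub>1 + complex_of_real b \<cdot>\<^sub>m \<sigma>\<^sub>2) = chi_div t n U l V m"
    using chi_form_attains_chi_div[OF mixture \<open>0 \<le> t\<close>] by blast
  moreover have "\<rho>\<^sub>1 \<in> carrier_mat n n" "\<sigma>\<^sub>1 \<in> carrier_mat n n" "\<rho>\<^sub>2 \<in> carrier_mat n n"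
    "\<sigma>\<^sub>2 \<in> carrier_mat n n"
    using pairs by (auto simp: spectral_pair_def dest: spectral_decompD(2))
  ultimately have "chi_div t n U l V m = a * chi_form t Y \<rho>\<^sub>1 \<sigma>\<^sub>1 + b * chi_form t Y \<rho>\<^sub>2 \<sigma>\<^sub>2"
    by (simp add: chi_form_linear[OF Y])
  also have "\<dots> \<le> a * chi_div t n U\<^sub>1 l\<^sub>1 V\<^sub>1 m\<^sub>1 + b * chi_div t n U\<^sub>2 l\<^sub>2 V\<^sub>2 m\<^sub>2"
    using pairs Y \<open>0 \<le> a\<close> \<open>0 \<le> b\<close> \<open>0 \<le> t\<close> by (intro add_mono mult_left_mono chi_form_le_chi_div)
  finally show ?thesis .
qed

theorem rel_entropy_jointly_convex:
  assumes mixture: "spectral_pair n (complex_of_real a \<cdot>\<^sub>m \<rho>\<^sub>1 + complex_of_real b \<cdot>\<^sub>m \<rho>\<^sub>2)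
      (complex_of_real a \<cdot>\<^sub>m \<sigma>\<^sub>1 + complex_of_real b \<cdot>\<^sub>m \<sigma>\<^sub>2) U l V m"
    and pairs: "spectral_pair n \<rho>\<^sub>1 \<sigma>\<^sub>1 U\<^sub>1 l\<^sub>1 V\<^sub>1 m\<^sub>1" "spectral_pair n \<rho>\<^sub>2 \<sigma>\<^sub>2 U\<^sub>2 l\<^sub>2 V\<^sub>2 m\<^sub>2"
    and ab: "0 \<le> a" "0 \<le> b"
  shows "rel_entropy n U l V m \<le> a * rel_entropy n U\<^sub>1 l\<^sub>1 V\<^sub>1 m\<^sub>1 + b * rel_entropy n U\<^sub>2 l\<^sub>2 V\<^sub>2 m\<^sub>2"
proof (rule has_integral_le[OF rel_entropy_has_integral[OF mixture] has_integral_add[OF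
      has_integral_mult_right[OF rel_entropy_has_integral[OF pairs(1)]]
      has_integral_mult_right[OF rel_entropy_has_integral[OF pairs(2)]]]])
  fix t :: real assume "t \<in> {0..}"
  hence "chi_div t n U l V m \<le> a * chi_div t n U\<^sub>1 l\<^sub>1 V\<^sub>1 m\<^sub>1 + b * chi_div t n U\<^sub>2 l\<^sub>2 V\<^sub>2 m\<^sub>2"
    using chi_div_jointly_convex[OF mixture pairs ab] by simp
  hence "chi_div t n U l V m / (1 + t)\<^sup>2
      \<le> (a * chi_div t n U\<^sub>1 l\<^sub>1 V\<^sub>1 m\<^sub>1 + b * chi_div t n U\<^sub>2 l\<^sub>2 V\<^sub>2 m\<^sub>2) / (1 + t)\<^sup>2"
    by (rule divide_right_mono) simp
  thus "chi_div t n U l V m / (1 + t)\<^sup>2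
      \<le> a * (chi_div t n U\<^sub>1 l\<^sub>1 V\<^sub>1 m\<^sub>1 / (1 + t)\<^sup>2) + b * (chi_div t n U\<^sub>2 l\<^sub>2 V\<^sub>2 m\<^sub>2 / (1 + t)\<^sup>2)"
    by (simp add: add_divide_distrib)
qed

section \<open>Entropy gain under twirling\<close>

definition twirl :: "complex mat \<Rightarrow> complex mat \<Rightarrow> complex mat" where
  "twirl D A = complex_of_real (1/2) \<cdot>\<^sub>m A + complex_of_real (1/2) \<cdot>\<^sub>m (D * A * cadj D)"

lemma twirl_carrier [simp]:
  "D \<in> carrier_mat n n \<Longrightarrow> A \<in> carrier_mat n n \<Longrightarrow> twirl D A \<in> carrier_mat n n"
  by (auto simp: twirl_def intro!: mult_carrier_mat[of _ n n])

lemma mtrace_twirl: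
  assumes D: "unitary_mat n D" and A: "A \<in> carrier_mat n n"
  shows "mtrace (twirl D A) = mtrace A"
proof -
  have "D * A * cadj D \<in> carrier_mat n n"
    using unitary_matD(1)[OF D] A by (auto intro!: mult_carrier_mat[of _ n n])
  hence "mtrace (twirl D A) = (mtrace A + mtrace (D * A * cadj D)) / 2"
    using A by (simp add: twirl_def mtrace_def sum.distrib sum_divide_distrib add_divide_distrib
      del: index_mult_mat)
  thus ?thesis by (simp add: mtrace_unitary_conj[OF assms])
qed

lemma born_prob_linear:
  assumes "V \<in> carrier_mat n n" "A \<in> carrier_mat n n" "B \<in> carrier_mat n n" "j < n"
  shows "born_prob V (complex_of_real a \<cdot>\<^sub>m A + complex_of_real b \<cdot>\<^sub>m B) j
    = a * born_prob V A j + b * born_prob V B j"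
proof -
  have "(\<Sum>k<n. \<Sum>l<n. cnj (V $$ (k,j)) * (complex_of_real a \<cdot>\<^sub>m A + complex_of_real b \<cdot>\<^sub>m B) $$ (k,l) * V $$ (l,j))
    = complex_of_real a * (\<Sum>k<n. \<Sum>l<n. cnj (V $$ (k,j)) * A $$ (k,l) * V $$ (l,j))
    + complex_of_real b * (\<Sum>k<n. \<Sum>l<n. cnj (V $$ (k,j)) * B $$ (k,l) * V $$ (l,j))"
    using assms by (simp add: sum.distrib sum_distrib_left algebra_simps)
  thus ?thesis using assms by (simp add: born_prob_sum[of _ n])
qed

lemma psd_mat_twirl:
  assumes A: "psd_mat n A" and D: "D \<in> carrier_mat n n"
  shows "psd_mat n (twirl D A)"
proof -
  have carrier: "A \<in> carrier_mat n n" "D * A * cadj D \<in> carrier_mat n n" and herm: "cadj A = A"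
    using A D by (auto simp: psd_mat_def intro!: mult_carrier_mat[of _ n n])
  have "cadj (D * A * cadj D) = D * A * cadj D"
    using carrier D herm by (simp add: cadj_mult mult_mat_assoc)
  hence "cadj (twirl D A) = twirl D A"
    using carrier D herm by (simp add: twirl_def cadj_add cadj_smult)
  moreover have "0 \<le> born_prob V (twirl D A) j" if V: "V \<in> carrier_mat n n" "j < n" for V j
  proof -
    have "cadj V * (D * A * cadj D) * V = cadj (cadj D * V) * A * (cadj D * V)"
      using carrier D V by (simp add: cadj_mult mult_mat_assoc)
    hence "born_prob V (D * A * cadj D) j = born_prob (cadj D * V) A j" by (simp add: born_prob_def)
    hence "born_prob V (twirl D A) j = (born_prob V A j + born_prob (cadj D * V) A j) / 2"
      unfolding twirl_def born_prob_linear[OF V(1) carrier V(2)] by simp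
    moreover have "0 \<le> born_prob V A j" "0 \<le> born_prob (cadj D * V) A j"
      using A D V mult_carrier_mat[of "cadj D" n n V n] by (simp_all add: psd_mat_def)
    ultimately show ?thesis by simp
  qed
  ultimately show ?thesis
    using twirl_carrier[OF D carrier(1)] by (simp add: psd_mat_def[of n "twirl D A"])
qed

lemma rel_entropy_twirl_le:
  assumes pair: "spectral_pair n \<rho> \<sigma> U l V m"
    and twirled: "spectral_pair n (twirl D \<rho>) (twirl D \<sigma>) U' l' V' m'"
    and D: "unitary_mat n D"
  shows "rel_entropy n U' l' V' m' \<le> rel_entropy n U l V m"
proof -
  have "spectral_pair n (D * \<rho> * cadj D) (D * \<sigma> * cadj D) (D * U) l (D * V) m"
    using pair D by (simp add: spectral_pair_def spectral_decomp_unitary_conj)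
  from rel_entropy_jointly_convex[OF twirled[unfolded twirl_def] pair this]
  have "rel_entropy n U' l' V' m' \<le> 1/2 * rel_entropy n U l V m
    + 1/2 * rel_entropy n (D * U) l (D * V) m"
    by simp
  moreover have "cadj (D * V) * (D * U) = cadj V * U"
    using pair by (intro cadj_mult_unitary[OF D])
      (auto simp: spectral_pair_def dest!: spectral_decompD(1) dest: unitary_matD(2))
  ultimately show ?thesis by (simp add: rel_entropy_def)
qed

theorem vn_entropy_twirl_gain:
  assumes \<rho>: "psd_mat n \<rho>" and D: "unitary_mat n D"
    and \<sigma>: "spectral_decomp n \<sigma> V m" "\<And>j. j < n \<Longrightarrow> 0 < m j"
    and \<sigma>': "spectral_decomp n (twirl D \<sigma>) V' m'" "\<And>j. j < n \<Longrightarrow> 0 < m' j"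
  shows "(\<Sum>j<n. log 2 (m j) * born_prob V \<rho> j) - (\<Sum>j<n. log 2 (m' j) * born_prob V' (twirl D \<rho>) j)
    \<le> vn_entropy (twirl D \<rho>) - vn_entropy \<rho>"
proof -
  obtain U l where "spectral_decomp n \<rho> U l" "\<And>i. i < n \<Longrightarrow> 0 \<le> l i"
    using psd_mat_spectral_decomp[OF \<rho>] by blast
  hence pair: "spectral_pair n \<rho> \<sigma> U l V m" using \<sigma> by (simp add: spectral_pair_def)
  obtain U' l' where "spectral_decomp n (twirl D \<rho>) U' l'" "\<And>i. i < n \<Longrightarrow> 0 \<le> l' i"
    using psd_mat_spectral_decomp[OF psd_mat_twirl[OF \<rho> unitary_matD(1)[OF D]]] by blast
  hence twirled: "spectral_pair n (twirl D \<rho>) (twirl D \<sigma>) U' l' V' m'"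
    using \<sigma>' by (simp add: spectral_pair_def)
  have "mtrace (twirl D \<rho>) = mtrace \<rho>" "mtrace (twirl D \<sigma>) = mtrace \<sigma>"
    using \<rho> spectral_decompD(2)[OF \<sigma>(1)] by (auto simp: mtrace_twirl[OF D] psd_mat_def)
  hence "(\<Sum>j<n. ln (m j) * born_prob V \<rho> j) - (\<Sum>j<n. ln (m' j) * born_prob V' (twirl D \<rho>) j)
    \<le> ln 2 * (vn_entropy (twirl D \<rho>) - vn_entropy \<rho>)"
    using rel_entropy_twirl_le[OF pair twirled D]
    by (simp add: rel_entropy_eq[OF pair] rel_entropy_eq[OF twirled] algebra_simps)
  thus ?thesis by (simp add: log_def field_simps flip: sum_divide_distrib)
qed

corollary vn_entropy_twirl_ge:
  assumes "psd_mat n \<rho>" "unitary_mat n D"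
  shows "vn_entropy \<rho> \<le> vn_entropy (twirl D \<rho>)"
proof -
  have one: "spectral_decomp n (1\<^sub>m n) (1\<^sub>m n) (\<lambda>_. 1)"
    using spectral_decomp_real_diag[of n "\<lambda>_. 1"] by simp
  have "twirl D (1\<^sub>m n) = 1\<^sub>m n"
    using unitary_matD[OF assms(2)] unfolding twirl_def by (intro eq_matI) auto
  with one have "spectral_decomp n (twirl D (1\<^sub>m n)) (1\<^sub>m n) (\<lambda>_. 1)" by simp
  from vn_entropy_twirl_gain[OF assms one _ this] show ?thesis by simp
qed

section \<open>Kraus representations and Choi matrices\<close>

definition pauli_dot :: "(nat \<Rightarrow> complex) \<Rightarrow> nat \<Rightarrow> nat \<Rightarrow> complex" where
  "pauli_dot w a b = (if a = 0 \<and> b = 0 then w 0 else if a = 0 then w 1 - \<i> * w 2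
     else if b = 0 then w 1 + \<i> * w 2 else - w 0)"

text \<open>With \<open>F\<close> extended linearly from density matrices, \<open>stokes_unit R t i j a b\<close> is
  \<open>\<langle>a| F(|i\<rangle>\<langle>j|) |b\<rangle>\<close>; \<open>kraus_unit\<close> is the same quantity in terms of Kraus operators.\<close>

definition stokes_unit :: "real mat \<Rightarrow> real vec \<Rightarrow> nat \<Rightarrow> nat \<Rightarrow> nat \<Rightarrow> nat \<Rightarrow> complex" where
  "stokes_unit R t i j a b =
    (if i = j
     then ((if a = b then 1 else 0)
        + pauli_dot (\<lambda>k. of_real (t $ k + (if i = 0 then 1 else - 1) * R $$ (k,0))) a b) / 2
     else pauli_dot (\<lambda>k. of_real (R $$ (k,1)) + (if i = 0 then \<i> else - \<i>) *
        of_real (R $$ (k,2))) a b / 2)"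

definition kraus_unit :: "complex mat list \<Rightarrow> nat \<Rightarrow> nat \<Rightarrow> nat \<Rightarrow> nat \<Rightarrow> complex" where
  "kraus_unit Ks i j a b = (\<Sum>K\<leftarrow>Ks. K $$ (a,i) * cnj (K $$ (b,j)))"

lemma bloch_index:
  assumes "\<rho> \<in> carrier_mat 2 2"
  shows "bloch \<rho> $ 0 = Re (\<rho> $$ (0,0) - \<rho> $$ (1,1))" "bloch \<rho> $ 1 = Re (\<rho> $$ (0,1) + \<rho> $$ (1,0))"
    "bloch \<rho> $ 2 = Im (\<rho> $$ (1,0) - \<rho> $$ (0,1))"
  using assms unfolding bloch_def
  by (simp_all add: mtrace_mult sum_lessThan_2 pauli_def sigma_z_def sigma_x_def sigma_y_def
    mat_of_rows_list_def)

lemma stokes_map_carrier: "stokes_map R t \<rho> \<in> carrier_mat 2 2"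
  unfolding stokes_map_def Let_def
  by (intro smult_carrier_mat add_carrier_mat) (auto simp: sigma_y_def mat_of_rows_list_def)

lemma stokes_map_index_pauli:
  assumes "a < 2" "b < 2"
  shows "stokes_map R t \<rho> $$ (a,b) = ((if a = b then 1 else 0)
    + pauli_dot (\<lambda>k. of_real ((R *\<^sub>v bloch \<rho> + t) $ k)) a b) / 2"
  using assms unfolding less_2_iff
  by (auto simp: stokes_map_def Let_def pauli_dot_def sigma_z_def sigma_x_def sigma_y_def
    mat_of_rows_list_def
      simp del: index_add_vec index_mult_mat_vec)

lemma stokes_map_index:
  assumes R: "R \<in> carrier_mat 3 3" "t \<in> carrier_vec 3" and \<rho>: "density \<rho>" and ab: "a < 2" "b < 2"
  shows "stokes_map R t \<rho> $$ (a,b) = (\<Sum>i<2. \<Sum>j<2. \<rho> $$ (i,j) * stokes_unit R t i j a b)"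
proof -
  have carrier: "\<rho> \<in> carrier_mat 2 2" using \<rho> by (simp add: density_def)
  have herm: "\<rho> $$ (i,j) = cnj (\<rho> $$ (j,i))" if "i < 2" "j < 2" for i j
    using \<rho> that carrier by (metis index_cadj carrier_matD density_def)
  define x where "x = Re (\<rho> $$ (0,0))"
  define z where "z = \<rho> $$ (0,1)"
  have entries: "\<rho> $$ (0,0) = of_real x" "\<rho> $$ (0,1) = z" "\<rho> $$ (1,0) = cnj z"
    using herm[of 0 0] herm[of 1 0] by (simp_all add: x_def z_def complex_eq_iff)
  moreover have "\<rho> $$ (0,0) + \<rho> $$ (1,1) = 1"
    using \<rho> carrier by (simp add: density_def mtrace_def sum_lessThan_2)
  ultimately have entry11: "\<rho> $$ (1,1) = of_real (1 - x)" by (simp add: algebra_simps)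
  have "(R *\<^sub>v bloch \<rho> + t) $ k = (\<Sum>l<3. R $$ (k,l) * bloch \<rho> $ l) + t $ k" if "k < 3" for k
    using R that by (simp add: scalar_prod_def bloch_def lessThan_atLeast0)
  hence vec: "(R *\<^sub>v bloch \<rho> + t) $ k = R $$ (k,0) * (2 * x - 1) + R $$ (k,1) * (2 * Re z)
    - R $$ (k,2) * (2 * Im z) + t $ k"
    if "k < 3" for k
    using that unfolding sum_lessThan_3 bloch_index[OF carrier] entries entry11 by simp
  show ?thesis
    unfolding stokes_map_index_pauli[OF ab] sum_lessThan_2 entries entry11
    using ab vec[of 0] vec[of 1] vec[of 2] unfolding less_2_iff
    by (elim disjE; simp add: stokes_unit_def pauli_dot_def complex_eq_iff
      del: index_add_vec index_mult_mat_vec;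
        simp add: field_simps)
qed

lemma density_pure:
  assumes "(cmod (w 0))\<^sup>2 + (cmod (w 1))\<^sup>2 = 1"
  shows "density (mat 2 2 (\<lambda>(i,j). w i * cnj (w j)))"
proof -
  let ?\<rho> = "mat 2 2 (\<lambda>(i,j). w i * cnj (w j))"
  have "cadj ?\<rho> = ?\<rho>" by (rule eq_matI) auto
  moreover have "mtrace ?\<rho> = of_real ((cmod (w 0))\<^sup>2 + (cmod (w 1))\<^sup>2)"
    unfolding of_real_add complex_norm_square by (simp add: mtrace_def sum_lessThan_2)
  hence "mtrace ?\<rho> = 1" by (simp only: assms of_real_1)
  moreover have "0 \<le> Re (\<Sum>i<2. cnj (v $ i) * (?\<rho> *\<^sub>v v) $ i)" if v: "v \<in> carrier_vec 2" for v
  proof -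
    have "(?\<rho> *\<^sub>v v) $ i = (\<Sum>j<2. w i * cnj (w j) * v $ j)" if "i < 2" for i
      using that v by (simp add: scalar_prod_def lessThan_atLeast0)
    hence "(\<Sum>i<2. cnj (v $ i) * (?\<rho> *\<^sub>v v) $ i)
        = cnj (\<Sum>j<2. cnj (w j) * v $ j) * (\<Sum>j<2. cnj (w j) * v $ j)"
      by (simp add: sum_lessThan_2 algebra_simps del: index_mult_mat_vec)
    thus ?thesis by (simp only: complex_of_real_cmod_sq[symmetric]) simp
  qed
  ultimately show ?thesis by (auto simp only: density_def mat_carrier)
qed

lemma kraus_apply_carrier:
  assumes "set Ks \<subseteq> carrier_mat 2 2" "\<rho> \<in> carrier_mat 2 2"
  shows "kraus_apply Ks \<rho> \<in> carrier_mat 2 2"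
  using assms by (induction Ks) (auto simp: kraus_apply_def)

lemma kraus_apply_index:
  assumes "set Ks \<subseteq> carrier_mat 2 2" "\<rho> \<in> carrier_mat 2 2" "a < 2" "b < 2"
  shows "kraus_apply Ks \<rho> $$ (a,b) = (\<Sum>i<2. \<Sum>j<2. \<rho> $$ (i,j) * kraus_unit Ks i j a b)"
  using assms
proof (induction Ks)
  case Nil
  thus ?case by (simp add: kraus_apply_def kraus_unit_def)
next
  case (Cons K Ks)
  have K: "K \<in> carrier_mat 2 2" and Ks: "kraus_apply Ks \<rho> \<in> carrier_mat 2 2"
    using Cons.prems kraus_apply_carrier[of Ks \<rho>] by auto
  have "kraus_apply (K # Ks) \<rho> $$ (a,b) = (K * \<rho> * cadj K) $$ (a,b) + kraus_apply Ks \<rho> $$ (a,b)"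
    using Ks Cons.prems by (simp add: kraus_apply_def del: index_mult_mat(1))
  also have "(K * \<rho> * cadj K) $$ (a,b) = (\<Sum>i<2. \<Sum>j<2. \<rho> $$ (i,j) * (K $$ (a,i) * cnj (K $$ (b,j))))"
    using K Cons.prems by (simp add: index_mult_mat_sum sum_lessThan_2 algebra_simps
      del: index_mult_mat(1))
  finally show ?case using Cons by (simp add: kraus_unit_def sum_lessThan_2 algebra_simps)
qed

lemma kraus_tp_carrier:
  assumes "set Ks \<subseteq> carrier_mat 2 2"
  shows "kraus_tp Ks \<in> carrier_mat 2 2"
  using assms by (induction Ks) (auto simp: kraus_tp_def)

lemma kraus_tp_index:
  assumes "set Ks \<subseteq> carrier_mat 2 2" "i < 2" "j < 2"
  shows "kraus_tp Ks $$ (i,j) = (\<Sum>a<2. kraus_unit Ks j i a a)"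
  using assms
proof (induction Ks)
  case Nil
  thus ?case by (simp add: kraus_tp_def kraus_unit_def)
next
  case (Cons K Ks)
  have K: "K \<in> carrier_mat 2 2" and Ks: "kraus_tp Ks \<in> carrier_mat 2 2"
    using Cons.prems kraus_tp_carrier[of Ks] by auto
  have "kraus_tp (K # Ks) $$ (i,j) = (cadj K * K) $$ (i,j) + kraus_tp Ks $$ (i,j)"
    using Ks Cons.prems by (simp add: kraus_tp_def del: index_mult_mat(1))
  also have "(cadj K * K) $$ (i,j) = (\<Sum>a<2. K $$ (a,j) * cnj (K $$ (a,i)))"
    using K Cons.prems by (simp add: index_mult_mat_sum mult.commute del: index_mult_mat(1))
  finally show ?case using Cons by (simp add: kraus_unit_def sum_lessThan_2 algebra_simps)
qed

lemma sesquilinear_form_ext_2: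
  fixes X Y :: "nat \<Rightarrow> nat \<Rightarrow> complex"
  assumes eq: "\<And>w. (cmod (w 0))\<^sup>2 + (cmod (w 1))\<^sup>2 = 1 \<Longrightarrow>
      (\<Sum>i<2. \<Sum>j<2. w i * cnj (w j) * X i j) = (\<Sum>i<2. \<Sum>j<2. w i * cnj (w j) * Y i j)"
    and ij: "i < 2" "j < 2"
  shows "X i j = Y i j"
proof -
  define Z where "Z i j = X i j - Y i j" for i j
  have form: "w0 * cnj w0 * Z 0 0 + w0 * cnj w1 * Z 0 1 + w1 * cnj w0 * Z 1 0 + w1 * cnj w1 * Z 1 1 = 0"
    if "(cmod w0)\<^sup>2 + (cmod w1)\<^sup>2 = 1" for w0 w1
    using eq[of "\<lambda>i. if i = 0 then w0 else w1"] that by (simp add: Z_def sum_lessThan_2 algebra_simps)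
  have diagonal: "Z 0 0 = 0" "Z 1 1 = 0" using form[of 1 0] form[of 0 1] by simp_all
  have "Z 0 1 + Z 1 0 = 0" "Z 0 1 - Z 1 0 = 0"
    using form[of "3/5" "4/5"] form[of "3/5" "4/5 * \<i>"] diagonal
    by (simp_all add: norm_mult power2_eq_square complex_eq_iff)
  hence "Z 0 1 = 0" "Z 1 0 = 0" by (simp_all add: algebra_simps eq_neg_iff_add_eq_0)
  with diagonal have "Z i j = 0" using ij by (auto simp: less_2_iff)
  thus ?thesis by (simp add: Z_def)
qed

lemma kraus_unit_eq_stokes_unit:
  assumes R: "R \<in> carrier_mat 3 3" "t \<in> carrier_vec 3" and K: "is_kraus_rep R t Ks"
    and ij: "i < 2" "j < 2" and ab: "a < 2" "b < 2"
  shows "kraus_unit Ks i j a b = stokes_unit R t i j a b"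
proof (rule sesquilinear_form_ext_2[OF _ ij])
  fix w :: "nat \<Rightarrow> complex" assume "(cmod (w 0))\<^sup>2 + (cmod (w 1))\<^sup>2 = 1"
  hence pure: "density (mat 2 2 (\<lambda>(i,j). w i * cnj (w j)))" (is "density ?\<rho>") by (rule density_pure)
  hence "kraus_apply Ks ?\<rho> $$ (a,b) = stokes_map R t ?\<rho> $$ (a,b)" and "set Ks \<subseteq> carrier_mat 2 2"
    using K by (auto simp: is_kraus_rep_def)
  thus "(\<Sum>i<2. \<Sum>j<2. w i * cnj (w j) * kraus_unit Ks i j a b)
      = (\<Sum>i<2. \<Sum>j<2. w i * cnj (w j) * stokes_unit R t i j a b)"
    by (simp add: kraus_apply_index[OF _ _ ab] stokes_map_index[OF R pure ab])
qed

lemma is_kraus_repI: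
  assumes R: "R \<in> carrier_mat 3 3" "t \<in> carrier_vec 3" and Ks: "Ks \<noteq> []" "set Ks \<subseteq> carrier_mat 2 2"
    and unit: "\<And>i j a b. i < 2 \<Longrightarrow> j < 2 \<Longrightarrow> a < 2 \<Longrightarrow> b < 2 \<Longrightarrow>
      kraus_unit Ks i j a b = stokes_unit R t i j a b"
  shows "is_kraus_rep R t Ks"
proof -
  have "kraus_tp Ks = 1\<^sub>m 2"
  proof (rule eq_matI)
    fix i j assume "i < dim_row (1\<^sub>m 2 :: complex mat)" "j < dim_col (1\<^sub>m 2 :: complex mat)"
    hence ij: "i < 2" "j < 2" by auto
    have "kraus_tp Ks $$ (i,j) = (\<Sum>a<2. stokes_unit R t j i a a)"
      using unit ij by (simp add: kraus_tp_index[OF Ks(2)])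
    also have "\<dots> = (if i = j then 1 else 0)"
      using ij unfolding less_2_iff
      by (elim disjE; simp add: sum_lessThan_2 stokes_unit_def pauli_dot_def; simp add: field_simps)
    finally show "kraus_tp Ks $$ (i,j) = 1\<^sub>m 2 $$ (i,j)" using ij by simp
  qed (use kraus_tp_carrier[OF Ks(2)] in auto)
  moreover have "kraus_apply Ks \<rho> = stokes_map R t \<rho>" if \<rho>: "density \<rho>" for \<rho>
  proof (rule eq_matI)
    have carrier: "\<rho> \<in> carrier_mat 2 2" using \<rho> by (simp add: density_def)
    show "dim_row (kraus_apply Ks \<rho>) = dim_row (stokes_map R t \<rho>)"
      "dim_col (kraus_apply Ks \<rho>) = dim_col (stokes_map R t \<rho>)"
      using kraus_apply_carrier[OF Ks(2) carrier] stokes_map_carrier[of R t \<rho>] by auto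
    fix a b assume "a < dim_row (stokes_map R t \<rho>)" "b < dim_col (stokes_map R t \<rho>)"
    hence ab: "a < 2" "b < 2" using stokes_map_carrier[of R t \<rho>] by auto
    show "kraus_apply Ks \<rho> $$ (a,b) = stokes_map R t \<rho> $$ (a,b)"
      unfolding kraus_apply_index[OF Ks(2) carrier ab] stokes_map_index[OF R \<rho> ab] using unit ab by simp
  qed
  ultimately show ?thesis using Ks by (simp add: is_kraus_rep_def)
qed

text \<open>Index \<open>2 * i + a\<close> stands for input basis state \<open>i\<close> and output basis state \<open>a\<close>. With
  \<open>M\<close> the matrix whose rows are the vectorised Kraus operators divided by \<open>\<surd>2\<close>, this is
  \<open>M\<^sup>* M\<close>, whereas the environment state is \<open>M M\<^sup>*\<close>; hence the complex conjugation.\<close>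

definition choi :: "real mat \<Rightarrow> real vec \<Rightarrow> complex mat" where
  "choi R t = mat 4 4 (\<lambda>(m,n). cnj (stokes_unit R t (m div 2) (n div 2) (m mod 2) (n mod 2)) / 2)"

definition choi_block :: "real mat \<Rightarrow> real vec \<Rightarrow> nat \<Rightarrow> complex mat" where
  "choi_block R t x = mat 2 2 (\<lambda>(a,b). cnj (stokes_unit R t x x a b) / 2)"

definition kraus_mat :: "complex mat list \<Rightarrow> complex mat" where
  "kraus_mat Ks = mat (length Ks) 4 (\<lambda>(k,m). Ks ! k $$ (m mod 2, m div 2) / of_real (sqrt 2))"

definition kraus_slice :: "complex mat list \<Rightarrow> nat \<Rightarrow> complex mat" where
  "kraus_slice Ks x = mat (length Ks) 2 (\<lambda>(k,a). Ks ! k $$ (a,x) / of_real (sqrt 2))"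

lemma choi_carrier [simp]: "choi R t \<in> carrier_mat 4 4" by (simp add: choi_def)

lemma choi_block_carrier [simp]: "choi_block R t x \<in> carrier_mat 2 2" by (simp add: choi_block_def)

lemma kraus_mat_carrier [simp]: "kraus_mat Ks \<in> carrier_mat (length Ks) 4" by (simp add: kraus_mat_def)

lemma kraus_slice_carrier [simp]: "kraus_slice Ks x \<in> carrier_mat (length Ks) 2"
  by (simp add: kraus_slice_def)

lemma of_real_sqrt_2_mult: "complex_of_real (sqrt 2) * complex_of_real (sqrt 2) = 2"
  by (simp flip: of_real_mult)

lemma cadj_mult_kraus_mat:
  assumes "R \<in> carrier_mat 3 3" "t \<in> carrier_vec 3" "is_kraus_rep R t Ks"
  shows "cadj (kraus_mat Ks) * kraus_mat Ks = choi R t"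
proof (rule eq_matI)
  fix i j assume "i < dim_row (choi R t)" "j < dim_col (choi R t)"
  hence ij: "i < 4" "j < 4" by (auto simp: choi_def)
  hence "(cadj (kraus_mat Ks) * kraus_mat Ks) $$ (i,j)
    = cnj (kraus_unit Ks (i div 2) (j div 2) (i mod 2) (j mod 2)) / 2"
    by (simp add: index_mult_mat_sum kraus_mat_def kraus_unit_def sum_list_sum_nth lessThan_atLeast0
        sum_divide_distrib of_real_sqrt_2_mult del: index_mult_mat(1))
  thus "(cadj (kraus_mat Ks) * kraus_mat Ks) $$ (i,j) = choi R t $$ (i,j)"
    using ij by (simp add: kraus_unit_eq_stokes_unit[OF assms] choi_def less_mult_imp_div_less)
qed (auto simp: choi_def kraus_mat_def)

lemma cadj_mult_kraus_slice:
  assumes "R \<in> carrier_mat 3 3" "t \<in> carrier_vec 3" "is_kraus_rep R t Ks" "x < 2"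
  shows "cadj (kraus_slice Ks x) * kraus_slice Ks x = choi_block R t x"
proof (rule eq_matI)
  fix a b assume "a < dim_row (choi_block R t x)" "b < dim_col (choi_block R t x)"
  hence ab: "a < 2" "b < 2" by (auto simp: choi_block_def)
  hence "(cadj (kraus_slice Ks x) * kraus_slice Ks x) $$ (a,b) = cnj (kraus_unit Ks x x a b) / 2"
    by (simp add: index_mult_mat_sum kraus_slice_def kraus_unit_def sum_list_sum_nth lessThan_atLeast0
        sum_divide_distrib of_real_sqrt_2_mult del: index_mult_mat(1))
  thus "(cadj (kraus_slice Ks x) * kraus_slice Ks x) $$ (a,b) = choi_block R t x $$ (a,b)"
    using assms(4) ab by (simp add: kraus_unit_eq_stokes_unit[OF assms(1-3)] choi_block_def)
qed (auto simp: choi_block_def kraus_slice_def)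

lemma kraus_mat_mult_cadj:
  "kraus_mat Ks * cadj (kraus_mat Ks)
    = kraus_slice Ks 0 * cadj (kraus_slice Ks 0) + kraus_slice Ks 1 * cadj (kraus_slice Ks 1)"
  by (rule eq_matI)
     (auto simp: index_mult_mat_sum kraus_mat_def kraus_slice_def sum_lessThan_2 sum_lessThan_4
        simp del: index_mult_mat(1))

lemma compl_channel_zproj:
  assumes Ks: "set (kraus_of R t) \<subseteq> carrier_mat 2 2" and x: "x < 2"
  shows "(1/2) \<cdot>\<^sub>m compl_channel R t (zproj x)
    = kraus_slice (kraus_of R t) x * cadj (kraus_slice (kraus_of R t) x)"
proof (rule eq_matI)
  let ?Ks = "kraus_of R t" and ?M = "kraus_slice (kraus_of R t) x"
  fix k l assume "k < dim_row (?M * cadj ?M)" "l < dim_col (?M * cadj ?M)"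
  hence kl: "k < length ?Ks" "l < length ?Ks" by (auto simp: kraus_slice_def)
  hence "?Ks ! k \<in> carrier_mat 2 2" "?Ks ! l \<in> carrier_mat 2 2" using Ks nth_mem by blast+
  hence "mtrace (?Ks ! k * zproj x * cadj (?Ks ! l))
    = (\<Sum>a<2. ?Ks ! k $$ (a,x) * cnj (?Ks ! l $$ (a,x)))"
    using x by (auto simp: mtrace_mult index_mult_mat_sum sum_lessThan_2 zproj_def less_2_iff
      simp del: index_mult_mat(1))
  thus "((1/2) \<cdot>\<^sub>m compl_channel R t (zproj x)) $$ (k,l) = (?M * cadj ?M) $$ (k,l)"
    using kl by (simp add: compl_channel_def Let_def index_mult_mat_sum kraus_slice_def
      sum_divide_distrib
        of_real_sqrt_2_mult del: index_mult_mat(1))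
qed (auto simp: compl_channel_def Let_def kraus_slice_def)

abbreviation phase_flip :: "complex mat" where
  "phase_flip \<equiv> real_diag 4 (\<lambda>i. if i < 2 then 1 else - 1)"

abbreviation pinching :: "complex mat \<Rightarrow> complex mat" where
  "pinching \<equiv> twirl phase_flip"

lemma unitary_mat_phase_flip: "unitary_mat 4 phase_flip"
  unfolding unitary_mat_def cadj_real_diag mat_diag_diag by (auto simp: mat_diag_def intro!: eq_matI)

lemma pinching_index:
  assumes "G \<in> carrier_mat 4 4" "m < 4" "n < 4"
  shows "pinching G $$ (m,n) = (if m < 2 \<longleftrightarrow> n < 2 then G $$ (m,n) else 0)"
  using assms by (auto simp: twirl_def simp del: index_mult_mat(1))

lemma pinching_choi:
  "pinching (choi R t) = four_block_mat (choi_block R t 0) (0\<^sub>m 2 2) (0\<^sub>m 2 2) (choi_block R t 1)"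
    (is "_ = ?B")
proof (rule eq_matI)
  fix m n assume "m < dim_row ?B" "n < dim_col ?B"
  hence mn: "m < 4" "n < 4" by (auto simp: choi_block_def)
  show "pinching (choi R t) $$ (m,n) = ?B $$ (m,n)"
    using mn unfolding pinching_index[OF choi_carrier mn] less_4_iff
    by (elim disjE; simp add: choi_def choi_block_def)
qed (auto simp: choi_block_def twirl_def)

lemma kraus_of_channel:
  assumes "is_channel R t"
  shows "is_kraus_rep R t (kraus_of R t)"
  using assms unfolding is_channel_def kraus_of_def by (auto intro: someI_ex)

lemma psd_mat_choi:
  assumes "is_channel R t"
  shows "psd_mat 4 (choi R t)"
  using assms cadj_mult_kraus_mat[OF _ _ kraus_of_channel[OF assms]] psd_mat_gram[OF kraus_mat_carrier]
  by (metis is_channel_def)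

theorem H_XE_choi:
  assumes "is_channel R t"
  shows "H_XE R t = vn_entropy (pinching (choi R t)) - vn_entropy (choi R t)"
proof -
  define Ks where "Ks = kraus_of R t"
  define M where "M = kraus_slice Ks"
  have Rt: "R \<in> carrier_mat 3 3" "t \<in> carrier_vec 3" and K: "is_kraus_rep R t Ks"
    using assms kraus_of_channel[OF assms] by (auto simp: is_channel_def Ks_def)
  have carrier: "M x * cadj (M x) \<in> carrier_mat (length Ks) (length Ks)" for x
    by (auto simp: M_def intro!: mult_carrier_mat[of _ _ 2])
  have env: "(1/2) \<cdot>\<^sub>m compl_channel R t (zproj x) = M x * cadj (M x)" if "x < 2" for x
    using K that by (simp add: compl_channel_zproj M_def Ks_def is_kraus_rep_def)
  have slice: "vn_entropy (M x * cadj (M x)) = vn_entropy (choi_block R t x)" if "x < 2" for x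
    unfolding cadj_mult_kraus_slice[OF Rt K that, symmetric] M_def
    by (rule vn_entropy_mult_swap[of _ "length Ks" 2]) auto
  have "H_XE R t = vn_entropy (four_block_mat (M 0 * cadj (M 0)) (0\<^sub>m (length Ks) (length Ks))
      (0\<^sub>m (length Ks) (length Ks)) (M 1 * cadj (M 1)))
        - vn_entropy (kraus_mat Ks * cadj (kraus_mat Ks))"
    unfolding kraus_mat_mult_cadj by (simp add: H_XE_def Let_def env M_def[symmetric] Ks_def[symmetric])
  also have "vn_entropy (kraus_mat Ks * cadj (kraus_mat Ks)) = vn_entropy (choi R t)"
    unfolding cadj_mult_kraus_mat[OF Rt K, symmetric]
    by (rule vn_entropy_mult_swap[of _ "length Ks" 4]) auto
  also have "vn_entropy (four_block_mat (M 0 * cadj (M 0)) (0\<^sub>m (length Ks) (length Ks))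
      (0\<^sub>m (length Ks) (length Ks)) (M 1 * cadj (M 1))) = vn_entropy (pinching (choi R t))"
    unfolding pinching_choi using carrier
    by (simp add: vn_entropy_four_block_triangular(1)[of _ "length Ks" _ "length Ks"]
        vn_entropy_four_block_triangular(1)[of _ 2 _ 2] slice)
  finally show ?thesis .
qed

lemma H_XE_nonneg: "is_channel R t \<Longrightarrow> 0 \<le> H_XE R t"
  using vn_entropy_twirl_ge[OF psd_mat_choi unitary_mat_phase_flip] by (simp add: H_XE_choi)

section \<open>Binary entropy\<close>

abbreviation bias_entropy :: "real \<Rightarrow> real" where
  "bias_entropy x \<equiv> bin_entropy ((1 + x) / 2)"

definition bias_cross_entropy :: "real \<Rightarrow> real \<Rightarrow> real" where
  "bias_cross_entropy x y = - ((1 + x) / 2 * log 2 ((1 + y) / 2)) - (1 - x) / 2 * log 2 ((1 - y) / 2)"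

lemma eta_mult:
  assumes "0 \<le> x" "0 \<le> y"
  shows "eta (x * y) = x * eta y + y * eta x"
proof (cases "x = 0 \<or> y = 0")
  case False
  thus ?thesis using assms by (simp add: eta_eq log_mult algebra_simps)
qed (auto simp: eta_def)

lemma eta_one_half: "eta (1/2) = 1/2"
  by (simp add: eta_def log_divide)

lemma bias_entropy_eta: "bias_entropy x = eta ((1 + x) / 2) + eta ((1 - x) / 2)"
proof -
  have "1 - (1 + x) / 2 = (1 - x) / 2" by (simp add: field_simps)
  thus ?thesis unfolding bin_entropy_def by (simp only:)
qed

lemma bias_entropy_minus: "bias_entropy (- x) = bias_entropy x"
  using bias_entropy_eta[of x] bias_entropy_eta[of "- x"] by simp

lemma bias_entropy_abs: "bias_entropy \<bar>x\<bar> = bias_entropy x"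
  using bias_entropy_minus[of x] by (cases "0 \<le> x") auto

lemma eta_halved_bits:
  assumes "\<bar>x\<bar> \<le> 1"
  shows "2 * eta ((1 + x) / 4) + 2 * eta ((1 - x) / 4) = 1 + bias_entropy x"
proof -
  have "eta (u / 4) = (u / 2 + eta (u / 2)) / 2" if "0 \<le> u" for u
    using eta_mult[of "u / 2" "1/2"] that by (simp add: eta_one_half)
  from this[of "1 + x"] this[of "1 - x"] show ?thesis
    using assms unfolding bias_entropy_eta by (simp add: abs_le_iff field_simps)
qed

lemma eta_product_bits:
  assumes "\<bar>x\<bar> \<le> 1" "\<bar>y\<bar> \<le> 1"
  shows "eta ((1 + x) * (1 + y) / 4) + eta ((1 - x) * (1 - y) / 4) + eta ((1 + x) * (1 - y) / 4)
    + eta ((1 - x) * (1 + y) / 4) = bias_entropy x + bias_entropy y"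
proof -
  have product: "eta (u * v / 4) = u / 2 * eta (v / 2) + v / 2 * eta (u / 2)" if "0 \<le> u" "0 \<le> v" for u v
    using eta_mult[of "u / 2" "v / 2"] that by simp
  have nonneg: "0 \<le> 1 + x" "0 \<le> 1 - x" "0 \<le> 1 + y" "0 \<le> 1 - y" using assms by auto
  show ?thesis
    unfolding bias_entropy_eta product[OF nonneg(1,3)] product[OF nonneg(1,4)] product[OF nonneg(2,3)]
      product[OF nonneg(2,4)]
    by (simp add: field_simps)
qed

lemma bias_cross_entropy_self: "\<bar>x\<bar> \<le> 1 \<Longrightarrow> bias_cross_entropy x x = bias_entropy x"
  unfolding bias_entropy_eta bias_cross_entropy_def by (simp add: eta_eq)

lemma gibbs_term:
  fixes u v :: real
  assumes "0 \<le> u" "0 < v"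
  shows "u * ln v \<le> u * ln u + (v - u)" and "u \<noteq> v \<Longrightarrow> u * ln v < u * ln u + (v - u)"
proof -
  have "u * ln v \<le> u * ln u + (v - u) \<and> (u \<noteq> v \<longrightarrow> u * ln v < u * ln u + (v - u))"
  proof (cases "u = 0")
    case False
    hence u_pos: "0 < u" using assms by simp
    define gap where "gap = v / u - 1 - ln (v / u)"
    have "u * ln v = u * ln u + (v - u) - u * gap"
      using u_pos assms by (simp add: gap_def ln_div field_simps)
    moreover have "0 \<le> gap" using u_pos assms ln_le_minus_one[of "v / u"] by (simp add: gap_def)
    moreover have "gap \<noteq> 0" if "u \<noteq> v"
      using ln_eq_minus_one[of "v / u"] u_pos assms that by (auto simp: gap_def)
    ultimately show ?thesis using u_pos by auto
  qed (use assms in auto)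
  thus "u * ln v \<le> u * ln u + (v - u)" and "u \<noteq> v \<Longrightarrow> u * ln v < u * ln u + (v - u)"
    by blast+
qed

lemma bias_cross_entropy_ln:
  "ln 2 * bias_cross_entropy x y = - ((1 + x) / 2 * ln ((1 + y) / 2)) - (1 - x) / 2 * ln ((1 - y) / 2)"
  unfolding bias_cross_entropy_def by (simp add: log_def right_diff_distrib)

lemma bias_entropy_le_cross_entropy:
  assumes "\<bar>x\<bar> \<le> 1" "\<bar>y\<bar> < 1"
  shows "bias_entropy x \<le> bias_cross_entropy x y" and "x \<noteq> y \<Longrightarrow> bias_entropy x < bias_cross_entropy x y"
proof -
  have "0 \<le> (1 + x) / 2" "0 \<le> (1 - x) / 2" "0 < (1 + y) / 2" "0 < (1 - y) / 2"
    using assms by auto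
  note gibbs = gibbs_term[OF this(1,3)] gibbs_term[OF this(2,4)]
  have "ln 2 * bias_entropy x \<le> ln 2 * bias_cross_entropy x y"
    using gibbs(1,3)
    unfolding bias_cross_entropy_self[OF assms(1), symmetric] bias_cross_entropy_ln
    by (simp add: field_simps)
  thus "bias_entropy x \<le> bias_cross_entropy x y" by simp
  assume "x \<noteq> y"
  hence "ln 2 * bias_entropy x < ln 2 * bias_cross_entropy x y"
    using gibbs(2,3)
    unfolding bias_cross_entropy_self[OF assms(1), symmetric] bias_cross_entropy_ln
    by (simp add: field_simps)
  thus "bias_entropy x < bias_cross_entropy x y" by simp
qed

lemma bias_entropy_strict_decreasing:
  assumes "\<bar>a\<bar> < x" "x \<le> 1"
  shows "bias_entropy x < bias_entropy a"
proof -
  define b where "b = \<bar>a\<bar>"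
  have b: "0 \<le> b" "b < x" "\<bar>b\<bar> < 1" using assms by (auto simp: b_def)
  have "bias_entropy x < bias_cross_entropy x b"
    using assms b by (intro bias_entropy_le_cross_entropy(2)) auto
  also have "\<dots> = bias_cross_entropy b b - (x - b) / 2 * (log 2 ((1 + b) / 2) - log 2 ((1 - b) / 2))"
    by (simp add: bias_cross_entropy_def field_simps)
  also have "\<dots> \<le> bias_cross_entropy b b"
    using b by (simp add: zero_le_mult_iff)
  also have "\<dots> = bias_entropy a"
    using b bias_entropy_abs[of a] by (simp add: bias_cross_entropy_self b_def)
  finally show ?thesis .
qed

lemma bias_entropy_decreasing:
  assumes "\<bar>a\<bar> \<le> x" "x \<le> 1"
  shows "bias_entropy x \<le> bias_entropy a"
  using assms bias_entropy_strict_decreasing[of a x] bias_entropy_abs[of a] by (cases "\<bar>a\<bar> = x") auto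

lemma bias_cross_entropy_scaled_le:
  fixes x k :: real
  assumes x: "\<bar>x\<bar> \<le> 1" and k: "0 < k" "k < 1"
  shows "bias_cross_entropy x (k * x) \<le> bias_entropy x - log 2 k"
proof -
  have scaled: "u * log 2 k + u * log 2 u \<le> u * log 2 v" if "0 \<le> u" "k * u \<le> v" for u v :: real
  proof (cases "u = 0")
    case False
    hence u_pos: "0 < u" using that by simp
    have "0 < v" using mult_pos_pos[OF k(1) u_pos] that(2) by linarith
    hence "log 2 (k * u) \<le> log 2 v" using u_pos k that by simp
    hence "log 2 k + log 2 u \<le> log 2 v" using u_pos k by (simp add: log_mult)
    from mult_left_mono[OF this, of u] show ?thesis using u_pos by (simp add: distrib_left)
  qed simp
  have "(1 + x) / 2 * log 2 k + (1 + x) / 2 * log 2 ((1 + x) / 2)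
    \<le> (1 + x) / 2 * log 2 ((1 + k * x) / 2)"
    "(1 - x) / 2 * log 2 k + (1 - x) / 2 * log 2 ((1 - x) / 2) \<le> (1 - x) / 2 * log 2 ((1 - k * x) / 2)"
    by (rule scaled; use x k in \<open>auto simp: field_simps\<close>)+
  moreover have "(1 + x) / 2 * log 2 k + (1 - x) / 2 * log 2 k = log 2 k" by (simp add: field_simps)
  ultimately show ?thesis
    unfolding bias_cross_entropy_self[OF x, symmetric] bias_cross_entropy_def by linarith
qed

section \<open>Rotations in the z-x plane\<close>

definition rot :: "real \<Rightarrow> real mat" where
  "rot \<theta> = mat 2 2 (\<lambda>(i,j). if i = j then cos \<theta> else if i = 0 then - sin \<theta> else sin \<theta>)"

abbreviation zx_diag :: "real \<Rightarrow> real \<Rightarrow> real mat" where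
  "zx_diag dz dx \<equiv> mat_diag 2 (\<lambda>i. if i = 0 then dz else dx)"

definition zx_block :: "real mat \<Rightarrow> real mat" where
  "zx_block R = mat 2 2 (\<lambda>(i,j). R $$ (i,j))"

lemma zx_block_carrier [simp]: "zx_block R \<in> carrier_mat 2 2" by (simp add: zx_block_def)

lemma dim_zx_block [simp]: "dim_row (zx_block R) = 2" "dim_col (zx_block R) = 2"
  by (simp_all add: zx_block_def)

lemma zx_block_index [simp]: "i < 2 \<Longrightarrow> j < 2 \<Longrightarrow> zx_block R $$ (i,j) = R $$ (i,j)"
  by (simp add: zx_block_def)

lemma rot_carrier [simp]: "rot \<theta> \<in> carrier_mat 2 2" by (simp add: rot_def)

lemma dim_rot [simp]: "dim_row (rot \<theta>) = 2" "dim_col (rot \<theta>) = 2" by (simp_all add: rot_def)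

lemma rot_index:
  "rot \<theta> $$ (0,0) = cos \<theta>" "rot \<theta> $$ (0,1) = - sin \<theta>" "rot \<theta> $$ (1,0) = sin \<theta>" "rot \<theta> $$ (1,1) = cos \<theta>"
  by (simp_all add: rot_def)

lemma eq_mat_2_iff:
  assumes "A \<in> carrier_mat 2 2" "B \<in> carrier_mat 2 2"
  shows "A = B \<longleftrightarrow> A $$ (0,0) = B $$ (0,0) \<and> A $$ (0,1) = B $$ (0,1) \<and> A $$ (1,0) = B $$ (1,0)
    \<and> A $$ (1,1) = B $$ (1,1)"
  using assms by (auto simp: mat_eq_iff less_2_iff)

lemma mult_index_2:
  "i < dim_row A \<Longrightarrow> j < dim_col B \<Longrightarrow> dim_col A = 2 \<Longrightarrow> dim_row B = 2 \<Longrightarrow>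
    (A * B) $$ (i,j) = A $$ (i,0) * B $$ (0,j) + A $$ (i,1) * B $$ (1,j)"
  by (simp add: index_mult_mat_sum sum_lessThan_2 del: index_mult_mat(1))

lemma rot_mult: "rot a * rot b = rot (a + b)"
  by (subst eq_mat_2_iff)
     (auto simp: mult_index_2 rot_index[unfolded One_nat_def] cos_add sin_add
       simp del: index_mult_mat(1) intro: mult_carrier_mat[of _ 2 2])

lemma rot_0: "rot 0 = 1\<^sub>m 2"
  by (subst eq_mat_2_iff) (auto simp: rot_def)

lemma SO2_rot: "rot \<theta> \<in> SO2"
proof -
  have "transpose_mat (rot \<theta>) = rot (- \<theta>)" by (subst eq_mat_2_iff) (auto simp: rot_def)
  moreover have "det (rot \<theta>) = 1"
    unfolding det_2x2[OF rot_carrier] rot_index using sin_cos_squared_add[of \<theta>]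
    by (simp add: power2_eq_square)
  ultimately show ?thesis by (simp add: SO2_def rot_mult rot_0)
qed

lemma SO2_cases:
  assumes "Q \<in> SO2"
  obtains \<theta> where "Q = rot \<theta>"
proof -
  have Q: "Q \<in> carrier_mat 2 2" "Q * transpose_mat Q = 1\<^sub>m 2" "det Q = 1"
    using assms by (auto simp: SO2_def)
  define a b c d where "a = Q $$ (0,0)" and "b = Q $$ (0,1)" and "c = Q $$ (1,0)" and "d = Q $$ (1,1)"
  note entries = a_def[symmetric] b_def[symmetric] c_def[symmetric] d_def[symmetric]
  have "(Q * transpose_mat Q) $$ (0,0) = 1" "(Q * transpose_mat Q) $$ (0,1) = 0" using Q by simp_all
  hence unit_row: "a * a + b * b = 1" and ortho: "a * c + b * d = 0"
    using Q(1) by (simp_all add: mult_index_2 entries[unfolded One_nat_def] del: index_mult_mat(1))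
  have det: "a * d - c * b = 1" using Q(3) det_2x2[OF Q(1)] by (simp add: entries[unfolded One_nat_def])
  have "d * (a * a + b * b) = a * (a * d - c * b) + b * (a * c + b * d)"
    "c * (a * a + b * b) = a * (a * c + b * d) - b * (a * d - c * b)" by (simp_all add: algebra_simps)
  hence second_row: "d = a" "c = - b" using unit_row ortho det by simp_all
  hence "a\<^sup>2 + c\<^sup>2 = 1" using unit_row by (simp add: power2_eq_square)
  then obtain \<theta> where "a = cos \<theta>" "c = sin \<theta>" using sincos_total_2pi by metis
  hence "Q = rot \<theta>"
    using Q(1) second_row
    by (subst eq_mat_2_iff) (auto simp: rot_index[unfolded One_nat_def] entries[unfolded One_nat_def])
  thus ?thesis by (rule that)
qed

lemma rot_left_inverse:
  assumes "Q \<in> carrier_mat 2 2" "Q * rot \<theta> = 1\<^sub>m 2"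
  shows "Q = rot (- \<theta>)"
proof -
  have "Q = (Q * rot \<theta>) * rot (- \<theta>)" using assms(1) by (simp add: mult_mat_assoc rot_mult rot_0)
  thus ?thesis using assms(2) by simp
qed

lemma collinear_vec_2_iff:
  fixes u v :: "'a::field vec"
  assumes "u \<in> carrier_vec 2" "v \<in> carrier_vec 2"
  shows "(\<exists>c. u = c \<cdot>\<^sub>v v \<or> v = c \<cdot>\<^sub>v u) \<longleftrightarrow> u $ 0 * v $ 1 = u $ 1 * v $ 0"
proof
  assume "u $ 0 * v $ 1 = u $ 1 * v $ 0"
  moreover have "v = 0 \<cdot>\<^sub>v u" if "v $ 0 = 0" "v $ 1 = 0"
    using assms that by (auto simp: vec_eq_iff less_2_iff)
  ultimately have "u = (u $ 0 / v $ 0) \<cdot>\<^sub>v v \<or> u = (u $ 1 / v $ 1) \<cdot>\<^sub>v v \<or> v = 0 \<cdot>\<^sub>v u"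
    using assms by (auto simp: vec_eq_iff less_2_iff field_simps)
  thus "\<exists>c. u = c \<cdot>\<^sub>v v \<or> v = c \<cdot>\<^sub>v u" by blast
qed (use assms in auto)

lemma zx_block_compensate:
  assumes "R \<in> carrier_mat 3 3" "QA \<in> carrier_mat 2 2" "QB \<in> carrier_mat 2 2"
  shows "zx_block (fst (compensate R t QA QB)) = QB * zx_block R * QA"
proof (rule eq_matI)
  fix i j assume "i < dim_row (QB * zx_block R * QA)" "j < dim_col (QB * zx_block R * QA)"
  hence "i < 2" "j < 2" using assms by auto
  thus "zx_block (fst (compensate R t QA QB)) $$ (i,j) = (QB * zx_block R * QA) $$ (i,j)"
    using assms
    by (simp add: compensate_def stokes_comp_def rot_channel_def index_mult_mat_sum sum_lessThan_2
      sum_lessThan_3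
        algebra_simps del: index_mult_mat(1))
qed (use assms in auto)

lemma snd_compensate_unital:
  assumes "R \<in> carrier_mat 3 3"
  shows "snd (compensate R (0\<^sub>v 3) QA QB) = 0\<^sub>v 3"
proof -
  have "M *\<^sub>v 0\<^sub>v 3 = 0\<^sub>v 3" if "M \<in> carrier_mat 3 3" for M :: "real mat"
    by (rule eq_vecI) (use that in auto)
  thus ?thesis using assms by (simp add: compensate_def stokes_comp_def rot_channel_def)
qed

lemma params_eq_iff:
  "params R t = params R' t' \<longleftrightarrow> zx_block R = zx_block R' \<and> t $ 0 = t' $ 0 \<and> t $ 1 = t' $ 1"
  by (subst eq_mat_2_iff) (auto simp: params_def)

section \<open>The minimising channel\<close>

text \<open>The entry \<open>dz * dx\<close> makes the Choi spectrum the product of the distributions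
  \<open>(1 \<plusminus> dz) / 2\<close> and \<open>(1 \<plusminus> dx) / 2\<close>, which maximises its entropy.\<close>

definition opt_R :: "real \<Rightarrow> real \<Rightarrow> real \<Rightarrow> real \<Rightarrow> real mat" where
  "opt_R dz dx \<alpha> \<beta> =
    four_block_mat (rot \<beta> * zx_diag dz dx * rot \<alpha>) (0\<^sub>m 2 1) (0\<^sub>m 1 2) (mat 1 1 (\<lambda>_. dz * dx))"

abbreviation opt_params :: "real \<Rightarrow> real \<Rightarrow> real \<Rightarrow> real \<Rightarrow> real \<times> real \<times> real \<times> real \<times> real \<times> real" where
  "opt_params dz dx \<alpha> \<beta> \<equiv> params (opt_R dz dx \<alpha> \<beta>) (0\<^sub>v 3)"

lemma opt_R_carrier [simp]: "opt_R dz dx \<alpha> \<beta> \<in> carrier_mat 3 3"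
  by (intro carrier_matI) (simp_all add: opt_R_def)

lemma zx_block_opt_R: "zx_block (opt_R dz dx \<alpha> \<beta>) = rot \<beta> * zx_diag dz dx * rot \<alpha>"
  by (rule eq_matI) (auto simp: opt_R_def)

lemma opt_R_index:
  "opt_R dz dx \<alpha> \<beta> $$ (0,0) = dz * cos \<alpha> * cos \<beta> - dx * sin \<alpha> * sin \<beta>"
  "opt_R dz dx \<alpha> \<beta> $$ (0,1) = - dz * sin \<alpha> * cos \<beta> - dx * cos \<alpha> * sin \<beta>"
  "opt_R dz dx \<alpha> \<beta> $$ (1,0) = dz * cos \<alpha> * sin \<beta> + dx * sin \<alpha> * cos \<beta>"
  "opt_R dz dx \<alpha> \<beta> $$ (1,1) = dx * cos \<alpha> * cos \<beta> - dz * sin \<alpha> * sin \<beta>"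
  "opt_R dz dx \<alpha> \<beta> $$ (2,0) = 0" "opt_R dz dx \<alpha> \<beta> $$ (2,1) = 0"
  "opt_R dz dx \<alpha> \<beta> $$ (0,2) = 0" "opt_R dz dx \<alpha> \<beta> $$ (1,2) = 0" "opt_R dz dx \<alpha> \<beta> $$ (2,2) = dz * dx"
  by (simp_all add: opt_R_def mult_index_2 rot_index[unfolded One_nat_def] mat_diag_def algebra_simps
      del: index_mult_mat(1))

lemma params_eq_opt_params:
  "zx_block R = rot \<beta> * zx_diag dz dx * rot \<alpha> \<Longrightarrow> params R (0\<^sub>v 3) = opt_params dz dx \<alpha> \<beta>"
  by (simp add: params_eq_iff zx_block_opt_R)

lemma params_compensate_rot:
  assumes R: "R \<in> carrier_mat 3 3" and svd: "zx_block R = rot \<beta> * zx_diag dz dx * rot \<alpha>"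
  shows "case_prod params (compensate R (0\<^sub>v 3) (rot \<phi>) (rot \<psi>)) = opt_params dz dx (\<alpha> + \<phi>) (\<beta> + \<psi>)"
proof -
  have "zx_block (fst (compensate R (0\<^sub>v 3) (rot \<phi>) (rot \<psi>)))
      = (rot \<psi> * rot \<beta>) * zx_diag dz dx * (rot \<alpha> * rot \<phi>)"
    by (simp add: zx_block_compensate[OF R] svd mult_mat_assoc)
  thus ?thesis
    by (simp add: split_def snd_compensate_unital[OF R] params_eq_opt_params rot_mult add.commute)
qed

lemma opt_R_column_norm:
  "(opt_R dz dx \<alpha> \<beta> $$ (0,0))\<^sup>2 + (opt_R dz dx \<alpha> \<beta> $$ (1,0))\<^sup>2 = (dz * cos \<alpha>)\<^sup>2 + (dx * sin \<alpha>)\<^sup>2"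
proof -
  have "(x * c - y * s)\<^sup>2 + (x * s + y * c)\<^sup>2 = (x\<^sup>2 + y\<^sup>2) * (s\<^sup>2 + c\<^sup>2)" for x y s c :: real
    by (simp add: power2_eq_square algebra_simps)
  from this[of "dz * cos \<alpha>" "cos \<beta>" "dx * sin \<alpha>" "sin \<beta>"] show ?thesis unfolding opt_R_index by simp
qed

lemma opt_R_column_norm_le:
  assumes "\<bar>dz\<bar> \<le> k" "\<bar>dx\<bar> \<le> k"
  shows "(opt_R dz dx \<alpha> \<beta> $$ (0,0))\<^sup>2 + (opt_R dz dx \<alpha> \<beta> $$ (1,0))\<^sup>2 \<le> k\<^sup>2"
proof -
  have "dz\<^sup>2 \<le> k\<^sup>2" "dx\<^sup>2 \<le> k\<^sup>2"
    using power_mono[OF assms(1) abs_ge_zero, of 2] power_mono[OF assms(2) abs_ge_zero, of 2]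
    by simp_all
  hence "dz\<^sup>2 * (cos \<alpha>)\<^sup>2 + dx\<^sup>2 * (sin \<alpha>)\<^sup>2 \<le> k\<^sup>2 * (cos \<alpha>)\<^sup>2 + k\<^sup>2 * (sin \<alpha>)\<^sup>2"
    by (intro add_mono mult_right_mono) auto
  also have "\<dots> = k\<^sup>2" by (simp flip: distrib_left)
  finally show ?thesis unfolding opt_R_column_norm by (simp add: power_mult_distrib)
qed

text \<open>The columns are the vectorised rotations by \<open>p\<close> and \<open>p + \<pi> / 2\<close> and the reflections
  with parameters \<open>q\<close> and \<open>q + \<pi> / 2\<close>, where \<open>p = (\<alpha> + \<beta>) / 2\<close> and \<open>q = (\<beta> - \<alpha>) / 2\<close>; they are the Kraus
  operators of the minimiser.\<close>

definition bell_entry :: "real \<Rightarrow> real \<Rightarrow> nat \<Rightarrow> nat \<Rightarrow> real" where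
  "bell_entry \<alpha> \<beta> m j =
     (let c = cos ((\<alpha> + \<beta>) / 2); s = sin ((\<alpha> + \<beta>) / 2);
           c' = cos ((\<beta> - \<alpha>) / 2); s' = sin ((\<beta> - \<alpha>) / 2) in
       [[c, - s, c', - s'], [s, c, s', c'], [- s, - c, s', c'], [c, - s, - c', s']] ! m ! j)"

definition bell :: "real \<Rightarrow> real \<Rightarrow> complex mat" where
  "bell \<alpha> \<beta> = mat 4 4 (\<lambda>(m,j). of_real (bell_entry \<alpha> \<beta> m j / sqrt 2))"

definition bell_weight :: "real \<Rightarrow> real \<Rightarrow> nat \<Rightarrow> real" where
  "bell_weight dz dx j =
     [(1 + dz) * (1 + dx), (1 - dz) * (1 - dx), (1 + dz) * (1 - dx), (1 - dz) * (1 + dx)] ! j / 4"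

definition block_weight :: "real \<Rightarrow> nat \<Rightarrow> real" where
  "block_weight a k = [1 + a, 1 - a, 1 - a, 1 + a] ! k / 4"

lemma half_angle:
  fixes p :: real
  shows "cos (p/2) * cos (p/2) = (1 + cos p) / 2" "sin (p/2) * sin (p/2) = (1 - cos p) / 2"
    "sin (p/2) * cos (p/2) = sin p / 2" "cos (p/2) * sin (p/2) = sin p / 2"
  using cos_double_cos[of "p/2"] cos_double_sin[of "p/2"] sin_double[of "p/2"]
  by (simp_all add: power2_eq_square)

lemma bell_carrier [simp]: "bell \<alpha> \<beta> \<in> carrier_mat 4 4" by (simp add: bell_def)

lemma dim_bell [simp]: "dim_row (bell \<alpha> \<beta>) = 4" "dim_col (bell \<alpha> \<beta>) = 4" by (simp_all add: bell_def)

lemma unitary_mat_bell: "unitary_mat 4 (bell \<alpha> \<beta>)"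
  unfolding unitary_mat_def
proof
  show "cadj (bell \<alpha> \<beta>) * bell \<alpha> \<beta> = 1\<^sub>m 4"
  proof (rule eq_matI)
    fix i j assume "i < dim_row (1\<^sub>m 4 :: complex mat)" "j < dim_col (1\<^sub>m 4 :: complex mat)"
    hence ij: "i < 4" "j < 4" by auto
    hence orthogonal: "(\<Sum>m<4. bell_entry \<alpha> \<beta> m i * bell_entry \<alpha> \<beta> m j) = (if i = j then 2 else 0)"
      unfolding less_4_iff
      by (elim disjE; simp add: bell_entry_def Let_def sum_lessThan_4 half_angle; simp add: field_simps)
    have "(cadj (bell \<alpha> \<beta>) * bell \<alpha> \<beta>) $$ (i,j)
        = of_real ((\<Sum>m<4. bell_entry \<alpha> \<beta> m i * bell_entry \<alpha> \<beta> m j) / 2)"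
      using ij by (simp add: index_mult_mat_sum bell_def sum_divide_distrib of_real_sqrt_2_mult
        del: index_mult_mat(1))
    thus "(cadj (bell \<alpha> \<beta>) * bell \<alpha> \<beta>) $$ (i,j) = 1\<^sub>m 4 $$ (i,j)"
      unfolding orthogonal using ij by auto
  qed (auto simp: bell_def)
qed simp

lemma stokes_unit_opt_R:
  assumes "i < 2" "j < 2" "a < 2" "b < 2"
  shows "stokes_unit (opt_R dz dx \<alpha> \<beta>) (0\<^sub>v 3) i j a b
    = of_real (\<Sum>l<4. bell_entry \<alpha> \<beta> (2 * i + a) l * bell_entry \<alpha> \<beta> (2 * j + b) l * bell_weight dz dx l)"
  using assms unfolding less_2_iff
  by (elim disjE; simp add: stokes_unit_def pauli_dot_def opt_R_index[unfolded One_nat_def]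
    bell_entry_def Let_def
      sum_lessThan_4 bell_weight_def half_angle complex_eq_iff;
      simp add: cos_add sin_add cos_diff sin_diff field_simps)

lemma spectral_decomp_choi_opt_R:
  "spectral_decomp 4 (choi (opt_R dz dx \<alpha> \<beta>) (0\<^sub>v 3)) (bell \<alpha> \<beta>) (bell_weight dz dx)"
proof -
  have "choi (opt_R dz dx \<alpha> \<beta>) (0\<^sub>v 3)
    = bell \<alpha> \<beta> * real_diag 4 (bell_weight dz dx) * cadj (bell \<alpha> \<beta>)" (is "_ = ?D")
  proof (rule eq_matI)
    fix m n assume "m < dim_row ?D" "n < dim_col ?D"
    hence mn: "m < 4" "n < 4" by (auto simp: bell_def)
    hence "?D $$ (m,n)
        = of_real ((\<Sum>l<4. bell_entry \<alpha> \<beta> m l * bell_entry \<alpha> \<beta> n l * bell_weight dz dx l) / 2)"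
      by (simp add: index_mult_mat_sum[of _ "bell \<alpha> \<beta> * real_diag 4 (bell_weight dz dx)"]
        del: index_mult_mat(1))
         (simp add: bell_def of_real_sqrt_2_mult mult_ac flip: sum_divide_distrib)
    thus "choi (opt_R dz dx \<alpha> \<beta>) (0\<^sub>v 3) $$ (m,n) = ?D $$ (m,n)"
      using mn stokes_unit_opt_R[of "m div 2" "n div 2" "m mod 2" "n mod 2" dz dx \<alpha> \<beta>]
      by (simp add: choi_def less_mult_imp_div_less del: index_mult_mat(1))
  qed (auto simp: choi_def bell_def)
  thus ?thesis by (simp add: spectral_decomp_def unitary_mat_bell)
qed

lemma vn_entropy_choi_opt_R:
  assumes "\<bar>dz\<bar> \<le> 1" "\<bar>dx\<bar> \<le> 1"
  shows "vn_entropy (choi (opt_R dz dx \<alpha> \<beta>) (0\<^sub>v 3)) = bias_entropy dz + bias_entropy dx"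
  using eta_product_bits[OF assms]
  by (simp add: vn_entropy_spectral_decomp[OF spectral_decomp_choi_opt_R]
    sum_lessThan_4 bell_weight_def)

lemma vn_entropy_pinching_choi_unital:
  fixes R :: "real mat"
  defines "r \<equiv> sqrt ((R $$ (0,0))\<^sup>2 + (R $$ (1,0))\<^sup>2 + (R $$ (2,0))\<^sup>2)"
  assumes "r \<le> 1"
  shows "vn_entropy (pinching (choi R (0\<^sub>v 3))) = 1 + bias_entropy r"
proof -
  have r: "0 \<le> r" "r * r = (R $$ (0,0))\<^sup>2 + (R $$ (1,0))\<^sup>2 + (R $$ (2,0))\<^sup>2" by (simp_all add: r_def)
  have "vn_entropy (choi_block R (0\<^sub>v 3) x) = eta ((1 + r) / 4) + eta ((1 - r) / 4)" if "x < 2" for x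
  proof (rule vn_entropy_2x2)
    have "(1 + r) / 4 * ((1 - r) / 4) = (1 - r * r) / 16" by (simp add: field_simps)
    thus "choi_block R (0\<^sub>v 3) x $$ (0,0) * choi_block R (0\<^sub>v 3) x $$ (1,1)
        - choi_block R (0\<^sub>v 3) x $$ (1,0) * choi_block R (0\<^sub>v 3) x $$ (0,1)
      = complex_of_real ((1 + r) / 4 * ((1 - r) / 4))"
      unfolding r using that
      by (simp add: choi_block_def stokes_unit_def pauli_dot_def complex_eq_iff power2_eq_square)
         (auto simp: field_simps)
  qed (use that in \<open>simp_all add: choi_block_def stokes_unit_def pauli_dot_def complex_eq_iff
    field_simps\<close>)
  thus ?thesis
    using eta_halved_bits[of r] r(1) \<open>r \<le> 1\<close>
    by (simp add: pinching_choi vn_entropy_four_block_triangular(1)[of _ 2 _ 2])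
qed

lemma spectral_decomp_pinching_choi_opt_R:
  assumes "opt_R dz dx \<alpha> \<beta> $$ (1,0) = 0"
  shows "spectral_decomp 4 (pinching (choi (opt_R dz dx \<alpha> \<beta>) (0\<^sub>v 3))) (1\<^sub>m 4)
    (block_weight (opt_R dz dx \<alpha> \<beta> $$ (0,0)))"
proof -
  have "pinching (choi (opt_R dz dx \<alpha> \<beta>) (0\<^sub>v 3))
    = real_diag 4 (block_weight (opt_R dz dx \<alpha> \<beta> $$ (0,0)))" (is "_ = ?D")
  proof (rule eq_matI)
    fix m n assume "m < dim_row ?D" "n < dim_col ?D"
    hence mn: "m < 4" "n < 4" by simp_all
    thus "pinching (choi (opt_R dz dx \<alpha> \<beta>) (0\<^sub>v 3)) $$ (m,n) = ?D $$ (m,n)"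
      using assms unfolding pinching_index[OF choi_carrier mn] less_4_iff
      by (elim disjE; simp add: choi_def stokes_unit_def pauli_dot_def opt_R_index(5)
        block_weight_def mat_diag_def)
  qed (simp_all add: twirl_def)
  thus ?thesis by (simp add: spectral_decomp_real_diag)
qed

lemma bell_weight_nonneg: "\<bar>dz\<bar> \<le> 1 \<Longrightarrow> \<bar>dx\<bar> \<le> 1 \<Longrightarrow> j < 4 \<Longrightarrow> 0 \<le> bell_weight dz dx j"
  unfolding less_4_iff by (auto simp: bell_weight_def)

lemma bell_weight_pos: "\<bar>dz\<bar> < 1 \<Longrightarrow> \<bar>dx\<bar> < 1 \<Longrightarrow> j < 4 \<Longrightarrow> 0 < bell_weight dz dx j"
  unfolding less_4_iff by (auto simp: bell_weight_def)

lemma block_weight_pos: "\<bar>a\<bar> < 1 \<Longrightarrow> j < 4 \<Longrightarrow> 0 < block_weight a j"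
  unfolding less_4_iff by (auto simp: block_weight_def)

lemma is_channel_opt_R:
  assumes le_1: "\<bar>dz\<bar> \<le> 1" "\<bar>dx\<bar> \<le> 1"
  shows "is_channel (opt_R dz dx \<alpha> \<beta>) (0\<^sub>v 3)"
proof -
  define K where "K l = mat 2 2
    (\<lambda>(a,i). complex_of_real (sqrt (bell_weight dz dx l) * bell_entry \<alpha> \<beta> (2 * i + a) l))" for l
  have "kraus_unit (map K [0..<4]) i j a b = stokes_unit (opt_R dz dx \<alpha> \<beta>) (0\<^sub>v 3) i j a b"
    if ij: "i < 2" "j < 2" "a < 2" "b < 2" for i j a b
  proof -
    have "K l $$ (a,i) * cnj (K l $$ (b,j))
        = of_real (bell_entry \<alpha> \<beta> (2 * i + a) l *
            bell_entry \<alpha> \<beta> (2 * j + b) l * bell_weight dz dx l)" if "l < 4" for l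
    proof -
      have "sqrt (bell_weight dz dx l) * x * (sqrt (bell_weight dz dx l) * y)
        = x * y * bell_weight dz dx l" for x y
        using real_sqrt_mult_self[of "bell_weight dz dx l"] bell_weight_nonneg[OF le_1 that]
        by (simp add: mult_ac)
      thus ?thesis using ij by (simp add: K_def flip: of_real_mult)
    qed
    hence "kraus_unit (map K [0..<4]) i j a b
        = (\<Sum>l<4. of_real (bell_entry \<alpha> \<beta> (2 * i + a) l *
            bell_entry \<alpha> \<beta> (2 * j + b) l * bell_weight dz dx l))"
      by (simp add: kraus_unit_def interv_sum_list_conv_sum_set_nat lessThan_atLeast0 o_def)
    thus ?thesis unfolding stokes_unit_opt_R[OF ij] by (simp only: of_real_sum)
  qed
  hence "is_kraus_rep (opt_R dz dx \<alpha> \<beta>) (0\<^sub>v 3) (map K [0..<4])"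
    by (intro is_kraus_repI) (auto simp: K_def)
  thus ?thesis by (auto simp: is_channel_def)
qed

section \<open>The minimal key rate\<close>

abbreviation opt_key_rate :: "real \<Rightarrow> real \<Rightarrow> real" where
  "opt_key_rate dz dx \<equiv> 1 - bias_entropy dz - bias_entropy dx"

lemma born_prob_bell_choi:
  assumes "j < 4"
  shows "born_prob (bell \<alpha> \<beta>) (choi R t) j =
    (let s = cos (\<alpha> + \<beta>) * (R $$ (0,0) + R $$ (1,1)) + sin (\<alpha> + \<beta>) * (R $$ (1,0) - R $$ (0,1));
         d = cos (\<beta> - \<alpha>) * (R $$ (0,0) - R $$ (1,1)) + sin (\<beta> - \<alpha>) * (R $$ (1,0) + R $$ (0,1))
     in [1 + R $$ (2,2) + s, 1 + R $$ (2,2) - s, 1 - R $$ (2,2) + d, 1 - R $$ (2,2) - d] ! j / 4)"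
proof -
  have "born_prob (bell \<alpha> \<beta>) (choi R t) j
      = Re (\<Sum>a<4. \<Sum>b<4. of_real (bell_entry \<alpha> \<beta> a j * bell_entry \<alpha> \<beta> b j / 2) * choi R t $$ (a,b))"
    unfolding born_prob_sum[OF bell_carrier choi_carrier assms]
    by (intro arg_cong[where f = Re] sum.cong refl) (use assms
      in \<open>auto simp: bell_def simp flip: of_real_mult\<close>)
  also have "\<dots> = (\<Sum>a<4. \<Sum>b<4. bell_entry \<alpha> \<beta> a j * bell_entry \<alpha> \<beta> b j / 2 * Re (choi R t $$ (a,b)))"
    by simp
  finally show ?thesis
    using assms unfolding less_4_iff
    by (elim disjE; simp add: sum_lessThan_4 choi_def stokes_unit_def pauli_dot_def bell_entry_def
      Let_def half_angle;
        simp add: field_simps)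
qed

lemma params_eq_opt_paramsD:
  assumes "params R t = opt_params dz dx \<alpha> \<beta>"
  shows "R $$ (0,0) = opt_R dz dx \<alpha> \<beta> $$ (0,0)" "R $$ (0,1) = opt_R dz dx \<alpha> \<beta> $$ (0,1)"
    "R $$ (1,0) = opt_R dz dx \<alpha> \<beta> $$ (1,0)" "R $$ (1,1) = opt_R dz dx \<alpha> \<beta> $$ (1,1)"
    "t $ 0 = 0" "t $ 1 = 0"
  using assms by (auto simp: params_def)

lemma born_prob_bell_choi_svd:
  assumes params: "params R t = opt_params dz dx \<alpha> \<beta>" and j: "j < 4"
  shows "born_prob (bell \<alpha> \<beta>) (choi R t) j =
    [1 + R $$ (2,2) + (dz + dx), 1 + R $$ (2,2) - (dz + dx),
     1 - R $$ (2,2) + (dz - dx), 1 - R $$ (2,2) - (dz - dx)] ! j / 4"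
proof -
  have "R $$ (0,0) + R $$ (1,1) = (dz + dx) * cos (\<alpha> + \<beta>)"
    "R $$ (1,0) - R $$ (0,1) = (dz + dx) * sin (\<alpha> + \<beta>)"
    "R $$ (0,0) - R $$ (1,1) = (dz - dx) * cos (\<beta> - \<alpha>)"
    "R $$ (1,0) + R $$ (0,1) = (dz - dx) * sin (\<beta> - \<alpha>)"
    unfolding params_eq_opt_paramsD[OF params] opt_R_index
    by (simp_all add: cos_add sin_add cos_diff sin_diff algebra_simps)
  moreover have "cos x * (y * cos x) + sin x * (y * sin x) = y" for x y :: real
  proof -
    have "cos x * (y * cos x) + sin x * (y * sin x) = y * ((sin x)\<^sup>2 + (cos x)\<^sup>2)"
      by (simp only: power2_eq_square algebra_simps)
    thus ?thesis by simp
  qed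
  ultimately show ?thesis unfolding born_prob_bell_choi[OF j] by (simp add: Let_def)
qed

lemma channel_singular_values_le_1:
  assumes "is_channel R t" "params R t = opt_params dz dx \<alpha> \<beta>"
  shows "\<bar>dz\<bar> \<le> 1" "\<bar>dx\<bar> \<le> 1"
proof -
  have "0 \<le> born_prob (bell \<alpha> \<beta>) (choi R t) j" if "j < 4" for j
    using psd_mat_choi[OF assms(1)] that by (simp add: psd_mat_def)
  from this[of 0] this[of 1] this[of 2] this[of 3] show "\<bar>dz\<bar> \<le> 1" "\<bar>dx\<bar> \<le> 1"
    by (simp_all add: born_prob_bell_choi_svd[OF assms(2)] abs_le_iff)
qed

lemma choi_diagonal:
  assumes "j < 4"
  shows "Re (choi R t $$ (j,j)) = [1 + (t $ 0 + R $$ (0,0)), 1 - (t $ 0 + R $$ (0,0)),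
    1 + (t $ 0 - R $$ (0,0)), 1 - (t $ 0 - R $$ (0,0))] ! j / 4"
  using assms unfolding less_4_iff
  by (elim disjE; simp add: choi_def stokes_unit_def pauli_dot_def)

lemma sum_log_bell_weight:
  assumes params: "params R t = opt_params dz dx \<alpha> \<beta>" and less_1: "\<bar>dz'\<bar> < 1" "\<bar>dx'\<bar> < 1"
  shows "(\<Sum>j<4. log 2 (bell_weight dz' dx' j) * born_prob (bell \<alpha> \<beta>) (choi R t) j)
    = - bias_cross_entropy dz dz' - bias_cross_entropy dx dx'"
proof -
  have product: "log 2 (x * y / 4) = log 2 (x / 2) + log 2 (y / 2)" if "0 < x" "0 < y" for x y :: real
    using that log_mult[of 2 "x / 2" "y / 2"] by simp
  have pos: "0 < 1 + dz'" "0 < 1 - dz'" "0 < 1 + dx'" "0 < 1 - dx'" using less_1 by auto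
  have weights: "bell_weight dz' dx' 0 = (1 + dz') * (1 + dx') / 4"
    "bell_weight dz' dx' 1 = (1 - dz') * (1 - dx') / 4"
    "bell_weight dz' dx' 2 = (1 + dz') * (1 - dx') / 4"
    "bell_weight dz' dx' 3 = (1 - dz') * (1 + dx') / 4"
    by (simp_all add: bell_weight_def)
  show ?thesis
    unfolding sum_lessThan_4 weights product[OF pos(1,3)] product[OF pos(2,4)] product[OF pos(1,4)]
      product[OF pos(2,3)]
    by (simp add: born_prob_bell_choi_svd[OF params] bias_cross_entropy_def)
       (simp add: field_simps)
qed

lemma sum_log_block_weight:
  assumes t: "t $ 0 = 0" and a: "\<bar>a\<bar> < 1"
  shows "(\<Sum>j<4. log 2 (block_weight a j) * born_prob (1\<^sub>m 4) (pinching (choi R t)) j)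
    = - bias_cross_entropy (R $$ (0,0)) a - 1"
proof -
  have half: "log 2 (x / 4) = log 2 (x / 2) - 1" if "0 < x" for x :: real
    using that log_divide[of 2 "x / 2" 2] by simp
  have pos: "0 < 1 + a" "0 < 1 - a" using a by auto
  have diagonal: "born_prob (1\<^sub>m 4) (pinching (choi R t)) j = Re (choi R t $$ (j,j))" if "j < 4" for j
  proof -
    have "cadj (1\<^sub>m 4) * pinching (choi R t) * 1\<^sub>m 4 = pinching (choi R t)"
      by (simp add: twirl_def)
    thus ?thesis by (simp add: born_prob_def pinching_index[OF choi_carrier that that])
  qed
  have weights: "block_weight a 0 = (1 + a) / 4" "block_weight a 1 = (1 - a) / 4"
    "block_weight a 2 = (1 - a) / 4" "block_weight a 3 = (1 + a) / 4"
    by (simp_all add: block_weight_def)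
  show ?thesis
    unfolding sum_lessThan_4 weights half[OF pos(1)] half[OF pos(2)]
    by (simp add: diagonal choi_diagonal t bias_cross_entropy_def) (simp add: field_simps)
qed

lemma H_XE_lower_bound:
  assumes chan: "is_channel R t" and params: "params R t = opt_params dz dx \<alpha> \<beta>"
    and less_1: "\<bar>dz'\<bar> < 1" "\<bar>dx'\<bar> < 1" and diagonal: "opt_R dz' dx' \<alpha> \<beta> $$ (1,0) = 0"
  shows "1 + bias_cross_entropy (R $$ (0,0)) (opt_R dz' dx' \<alpha> \<beta> $$ (0,0))
      - bias_cross_entropy dz dz' - bias_cross_entropy dx dx' \<le> H_XE R t"
proof -
  define a where "a = opt_R dz' dx' \<alpha> \<beta> $$ (0,0)"
  define k where "k = max \<bar>dz'\<bar> \<bar>dx'\<bar>"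
  have "a\<^sup>2 \<le> k\<^sup>2" using opt_R_column_norm_le[of dz' k dx' \<alpha> \<beta>] diagonal by (simp add: a_def k_def)
  moreover have "0 \<le> k" "k < 1" using less_1 by (auto simp: k_def)
  ultimately have a: "\<bar>a\<bar> < 1" using abs_le_square_iff[of a k] by auto
  have "(\<Sum>j<4. log 2 (bell_weight dz' dx' j) * born_prob (bell \<alpha> \<beta>) (choi R t) j)
      - (\<Sum>j<4. log 2 (block_weight a j) * born_prob (1\<^sub>m 4) (pinching (choi R t)) j)
    \<le> vn_entropy (pinching (choi R t)) - vn_entropy (choi R t)"
    by (rule vn_entropy_twirl_gain[OF psd_mat_choi[OF chan] unitary_mat_phase_flip
          spectral_decomp_choi_opt_R bell_weight_pos[OF less_1]
          spectral_decomp_pinching_choi_opt_R[OF diagonal, folded a_def] block_weight_pos[OF a]])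
  thus ?thesis
    unfolding sum_log_bell_weight[OF params less_1]
      sum_log_block_weight[OF params_eq_opt_paramsD(5)[OF params] a]
      H_XE_choi[OF chan] by (simp add: a_def)
qed

lemma P_XY_index:
  assumes "R \<in> carrier_mat 3 3" "t \<in> carrier_vec 3" "x < 2" "y < 2"
  shows "P_XY R t x y
    = (1 + (if y = 0 then 1 else - 1) * (t $ 0 + (if x = 0 then 1 else - 1) * R $$ (0,0))) / 4"
proof -
  have "zproj x = mat 2 2 (\<lambda>(i,j). (if i = x then 1 else 0) * cnj (if j = x then 1 else 0))"
    by (rule eq_matI) (auto simp: zproj_def)
  moreover have "density (mat 2 2 (\<lambda>(i,j). (if i = x then 1 else 0) * cnj (if j = x then 1 else 0)))"
    using assms(3) by (intro density_pure) auto
  ultimately have "density (zproj x)" by simp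
  thus ?thesis
    unfolding P_XY_def stokes_map_index[OF assms(1,2) \<open>density (zproj x)\<close> assms(4,4)] using assms(3,4)
    unfolding less_2_iff by (auto simp: stokes_unit_def pauli_dot_def zproj_def sum_lessThan_2)
qed

lemma H_XY_cong_params:
  assumes "is_channel R t" "is_channel R' t'" "params R t = params R' t'"
  shows "H_XY R t = H_XY R' t'"
  using assms by (simp add: H_XY_def P_XY_index is_channel_def params_def)

lemma H_XY_eq_bias_entropy:
  assumes "is_channel R t" "t $ 0 = 0" "\<bar>R $$ (0,0)\<bar> \<le> 1"
  shows "H_XY R t = bias_entropy (R $$ (0,0))"
proof -
  have "H_XY R t = 2 * eta ((1 + R $$ (0,0)) / 4) + 2 * eta ((1 - R $$ (0,0)) / 4) - 2 * eta (1/2)"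
    using assms by (simp add: H_XY_def P_XY_index is_channel_def sum_lessThan_2
      add_divide_distrib[symmetric])
  thus ?thesis unfolding eta_halved_bits[OF assms(3)] by (simp add: eta_one_half)
qed

lemma bdd_below_key_rate: "bdd_below ((\<lambda>(R,t). key_rate R t) ` P_ba \<omega>)"
proof (cases "P_ba \<omega> = {}")
  case False
  then obtain R t where Rt: "is_channel R t" "params R t = \<omega>" by (auto simp: P_ba_def)
  have "- H_XY R t \<le> key_rate R' t'" if "is_channel R' t'" "params R' t' = \<omega>" for R' t'
    using H_XE_nonneg[OF that(1)] H_XY_cong_params[OF that(1) Rt(1)] that(2) Rt(2)
    by (simp add: key_rate_def)
  thus ?thesis by (intro bdd_belowI[of _ "- H_XY R t"]) (auto simp: P_ba_def)
qed simp

lemma opt_R_scaled_index: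
  "opt_R (k * dz) (k * dx) \<alpha> \<beta> $$ (0,0) = k * opt_R dz dx \<alpha> \<beta> $$ (0,0)"
  "opt_R (k * dz) (k * dx) \<alpha> \<beta> $$ (1,0) = k * opt_R dz dx \<alpha> \<beta> $$ (1,0)"
  unfolding opt_R_index by (simp_all add: algebra_simps)

lemma abs_scaled_less_1:
  fixes x k :: "'a::linordered_idom"
  assumes "\<bar>x\<bar> \<le> 1" "0 < k" "k < 1"
  shows "\<bar>k * x\<bar> < 1"
proof -
  have "k * \<bar>x\<bar> \<le> k * 1" using assms by (intro mult_left_mono) auto
  also have "\<dots> < 1" using assms by simp
  finally show ?thesis using assms by (simp add: abs_mult)
qed

text \<open>For \<open>\<bar>dz\<bar> = 1\<close> or \<open>\<bar>dx\<bar> = 1\<close> the minimiser has a singular Choi state, so the comparison is made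
  with the minimiser for \<open>k * dz\<close>, \<open>k * dx\<close> and then \<open>k\<close> tends to 1.\<close>

lemma opt_key_rate_le_key_rate:
  assumes chan: "is_channel R t" and params: "params R t = opt_params dz dx \<alpha> \<beta>"
    and diagonal: "opt_R dz dx \<alpha> \<beta> $$ (1,0) = 0"
  shows "opt_key_rate dz dx \<le> key_rate R t"
proof -
  define a where "a = R $$ (0,0)"
  note le_1 = channel_singular_values_le_1[OF chan params]
  have a_eq: "a = opt_R dz dx \<alpha> \<beta> $$ (0,0)"
    using params_eq_opt_paramsD(1)[OF params] by (simp add: a_def)
  have a: "\<bar>a\<bar> \<le> 1"
    using opt_R_column_norm_le[OF le_1, of \<alpha> \<beta>] unfolding diagonal a_eq[symmetric]
    by (simp add: abs_square_le_1)
  have bound: "1 + bias_entropy a - bias_entropy dz - bias_entropy dx + 2 * log 2 k \<le> H_XE R t"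
    if k: "0 < k" "k < 1" for k
  proof -
    note strict = abs_scaled_less_1[OF _ k]
    have diagonal': "opt_R (k * dz) (k * dx) \<alpha> \<beta> $$ (1,0) = 0"
      by (simp only: opt_R_scaled_index diagonal mult_zero_right)
    have "1 + bias_entropy a - (bias_entropy dz - log 2 k) - (bias_entropy dx - log 2 k)
      \<le> 1 + bias_cross_entropy a (k * a) - bias_cross_entropy dz (k * dz)
        - bias_cross_entropy dx (k * dx)"
      by (intro diff_mono add_left_mono bias_entropy_le_cross_entropy(1)
        bias_cross_entropy_scaled_le a le_1 k strict)
    also have "\<dots> \<le> H_XE R t"
      using H_XE_lower_bound[OF chan params strict[OF le_1(1)] strict[OF le_1(2)] diagonal']
      unfolding opt_R_scaled_index a_eq[symmetric] a_def[symmetric] .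
    finally show ?thesis by simp
  qed
  have "1 + bias_entropy a - bias_entropy dz - bias_entropy dx \<le> H_XE R t"
  proof (rule field_le_epsilon)
    fix e :: real assume "0 < e"
    thus "1 + bias_entropy a - bias_entropy dz - bias_entropy dx \<le> H_XE R t + e"
      using bound[of "2 powr (- e / 2)"] by (simp add: powr_less_one)
  qed
  moreover have "H_XY R t = bias_entropy a"
    using H_XY_eq_bias_entropy[OF chan params_eq_opt_paramsD(5)[OF params]] a by (simp add: a_def)
  ultimately show ?thesis by (simp add: key_rate_def)
qed

lemma key_rate_opt_R:
  fixes dz dx \<alpha> \<beta> :: real
  assumes le_1: "\<bar>dz\<bar> \<le> 1" "\<bar>dx\<bar> \<le> 1"
  defines "a \<equiv> opt_R dz dx \<alpha> \<beta> $$ (0,0)" and "b \<equiv> opt_R dz dx \<alpha> \<beta> $$ (1,0)"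
  shows "key_rate (opt_R dz dx \<alpha> \<beta>) (0\<^sub>v 3)
    = opt_key_rate dz dx + bias_entropy (sqrt (a\<^sup>2 + b\<^sup>2)) - bias_entropy a"
proof -
  have norm: "a\<^sup>2 + b\<^sup>2 \<le> 1" using opt_R_column_norm_le[OF le_1, of \<alpha> \<beta>] by (simp add: a_def b_def)
  hence "a\<^sup>2 \<le> 1" using zero_le_power2[of b] by linarith
  hence "H_XY (opt_R dz dx \<alpha> \<beta>) (0\<^sub>v 3) = bias_entropy a"
    using H_XY_eq_bias_entropy[OF is_channel_opt_R[OF le_1]] by (simp add: a_def abs_square_le_1)
  moreover have "vn_entropy (pinching (choi (opt_R dz dx \<alpha> \<beta>) (0\<^sub>v 3)))
    = 1 + bias_entropy (sqrt (a\<^sup>2 + b\<^sup>2))"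
    using vn_entropy_pinching_choi_unital[of "opt_R dz dx \<alpha> \<beta>"] norm
    by (simp only: a_def b_def opt_R_index(5)) simp
  ultimately show ?thesis
    by (simp add: key_rate_def H_XE_choi[OF is_channel_opt_R[OF le_1]] vn_entropy_choi_opt_R[OF le_1])
qed

lemma key_rate_opt_R_le:
  assumes le_1: "\<bar>dz\<bar> \<le> 1" "\<bar>dx\<bar> \<le> 1"
  shows "key_rate (opt_R dz dx \<alpha> \<beta>) (0\<^sub>v 3) \<le> opt_key_rate dz dx"
    and "opt_R dz dx \<alpha> \<beta> $$ (1,0) \<noteq> 0 \<Longrightarrow> key_rate (opt_R dz dx \<alpha> \<beta>) (0\<^sub>v 3) < opt_key_rate dz dx"
proof -
  define a b where "a = opt_R dz dx \<alpha> \<beta> $$ (0,0)" and "b = opt_R dz dx \<alpha> \<beta> $$ (1,0)"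
  note key_rate = key_rate_opt_R[OF le_1, of \<alpha> \<beta>, folded a_def b_def]
  have "a\<^sup>2 + b\<^sup>2 \<le> 1" using opt_R_column_norm_le[OF le_1, of \<alpha> \<beta>] by (simp add: a_def b_def)
  hence norm: "\<bar>a\<bar> \<le> sqrt (a\<^sup>2 + b\<^sup>2)" "sqrt (a\<^sup>2 + b\<^sup>2) \<le> 1" by (auto intro: real_le_rsqrt)
  show "key_rate (opt_R dz dx \<alpha> \<beta>) (0\<^sub>v 3) \<le> opt_key_rate dz dx"
    using bias_entropy_decreasing[OF norm] by (simp add: key_rate)
  assume "opt_R dz dx \<alpha> \<beta> $$ (1,0) \<noteq> 0"
  hence "\<bar>a\<bar> < sqrt (a\<^sup>2 + b\<^sup>2)" by (intro real_less_rsqrt) (simp add: b_def)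
  from bias_entropy_strict_decreasing[OF this norm(2)]
  show "key_rate (opt_R dz dx \<alpha> \<beta>) (0\<^sub>v 3) < opt_key_rate dz dx" by (simp add: key_rate)
qed

lemma min_K_le_key_rate_opt_R:
  assumes "\<bar>dz\<bar> \<le> 1" "\<bar>dx\<bar> \<le> 1"
  shows "min_K (opt_params dz dx \<alpha> \<beta>) \<le> key_rate (opt_R dz dx \<alpha> \<beta>) (0\<^sub>v 3)"
  unfolding min_K_def using is_channel_opt_R[OF assms]
  by (intro cInf_lower bdd_below_key_rate) (force simp: P_ba_def)

lemma key_rate_opt_params_is_minimum:
  assumes le_1: "\<bar>dz\<bar> \<le> 1" "\<bar>dx\<bar> \<le> 1" and diagonal: "opt_R dz dx \<alpha> \<beta> $$ (1,0) = 0"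
  shows "is_minimum ((\<lambda>(R,t). key_rate R t) ` P_ba (opt_params dz dx \<alpha> \<beta>)) (opt_key_rate dz dx)"
proof -
  have "key_rate (opt_R dz dx \<alpha> \<beta>) (0\<^sub>v 3) = opt_key_rate dz dx"
    unfolding key_rate_opt_R[OF le_1] diagonal by (simp add: bias_entropy_abs)
  moreover have "(opt_R dz dx \<alpha> \<beta>, 0\<^sub>v 3) \<in> P_ba (opt_params dz dx \<alpha> \<beta>)"
    using is_channel_opt_R[OF le_1] by (simp add: P_ba_def)
  ultimately show ?thesis
    using opt_key_rate_le_key_rate[OF _ _ diagonal] unfolding is_minimum_def by (force simp: P_ba_def)
qed

lemma min_K_eq_if_is_minimum: "is_minimum ((\<lambda>(R,t). key_rate R t) ` P_ba \<omega>) v \<Longrightarrow> min_K \<omega> = v"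
  unfolding is_minimum_def min_K_def by (auto intro: cInf_eq_minimum)

lemma min_K_opt_params_le:
  assumes "\<bar>dz\<bar> \<le> 1" "\<bar>dx\<bar> \<le> 1"
  shows "min_K (opt_params dz dx \<alpha> \<beta>) \<le> opt_key_rate dz dx"
  using min_K_le_key_rate_opt_R[OF assms] key_rate_opt_R_le(1)[OF assms] by (rule order_trans)

lemma min_K_opt_params_eq_iff:
  assumes "\<bar>dz\<bar> \<le> 1" "\<bar>dx\<bar> \<le> 1"
  shows "min_K (opt_params dz dx \<alpha> \<beta>) = opt_key_rate dz dx \<longleftrightarrow> opt_R dz dx \<alpha> \<beta> $$ (1,0) = 0"
proof (cases "opt_R dz dx \<alpha> \<beta> $$ (1,0) = 0")
  case True
  thus ?thesis using min_K_eq_if_is_minimum[OF key_rate_opt_params_is_minimum[OF assms True]] by blast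
next
  case False
  have "min_K (opt_params dz dx \<alpha> \<beta>) < opt_key_rate dz dx"
    using min_K_le_key_rate_opt_R[OF assms] key_rate_opt_R_le(2)[OF assms False] by (rule le_less_trans)
  with False show ?thesis by simp
qed

lemma collinear_svd_iff:
  "(\<exists>c. col (zx_diag dz dx * rot \<alpha>) 0 = c \<cdot>\<^sub>v row (rot \<beta>) 0
      \<or> row (rot \<beta>) 0 = c \<cdot>\<^sub>v col (zx_diag dz dx * rot \<alpha>) 0)
    \<longleftrightarrow> opt_R dz dx \<alpha> \<beta> $$ (1,0) = 0"
proof -
  have "col (zx_diag dz dx * rot \<alpha>) 0 \<in> carrier_vec 2" "row (rot \<beta>) 0 \<in> carrier_vec 2"
    by (auto intro!: carrier_vecI)
  from collinear_vec_2_iff[OF this] show ?thesis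
    by (auto simp: rot_index[unfolded One_nat_def] opt_R_index[unfolded One_nat_def]
      simp del: index_mult_mat(1))
qed

lemma is_maximum_min_K_compensate:
  assumes R: "R \<in> carrier_mat 3 3" and svd: "zx_block R = rot \<beta> * zx_diag dz dx * rot \<alpha>"
    and le_1: "\<bar>dz\<bar> \<le> 1" "\<bar>dx\<bar> \<le> 1"
  shows "is_maximum {min_K (case_prod params (compensate R (0\<^sub>v 3) QA QB)) | QA QB. QA \<in> SO2 \<and> QB \<in> SO2}
    (opt_key_rate dz dx)"
proof -
  note compensated = params_compensate_rot[OF R svd]
  have "min_K (case_prod params (compensate R (0\<^sub>v 3) (rot (- \<alpha>)) (rot (- \<beta>)))) = opt_key_rate dz dx"
    unfolding compensated min_K_opt_params_eq_iff[OF le_1]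
    by (simp add: opt_R_index[unfolded One_nat_def])
  hence "opt_key_rate dz dx \<in> {min_K (case_prod params (compensate R (0\<^sub>v 3) QA QB)) | QA QB. QA \<in> SO2 \<and> QB \<in> SO2}"
    using SO2_rot by (metis (mono_tags, lifting) mem_Collect_eq)
  moreover have "min_K (case_prod params (compensate R (0\<^sub>v 3) QA QB)) \<le> opt_key_rate dz dx"
    if "QA \<in> SO2" "QB \<in> SO2" for QA QB
    using that min_K_opt_params_le[OF le_1] by (elim SO2_cases) (simp only: compensated)
  ultimately show ?thesis unfolding is_maximum_def by blast
qed

theorem theorem3:
  fixes R :: "real mat" and t :: "real vec" and U V QAs QBs :: "real mat" and dz dx :: real
  assumes chan: "is_channel R t"
    and unital: "t = 0\<^sub>v 3"
    and U: "U \<in> SO2" and V: "V \<in> SO2"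
    and svd: "mat 2 2 (\<lambda>(i,j). R $$ (i,j)) = V * mat_diag 2 (\<lambda>i. if i = 0 then dz else dx) * U"
    and QAs: "QAs \<in> carrier_mat 2 2" "QAs * U = 1\<^sub>m 2" "U * QAs = 1\<^sub>m 2"
    and QBs: "QBs \<in> carrier_mat 2 2" "QBs * V = 1\<^sub>m 2" "V * QBs = 1\<^sub>m 2"
  shows "let Es = compensate R t QAs QBs; \<omega>s = params (fst Es) (snd Es);
             val = 1 - bin_entropy ((1 + dz) / 2) - bin_entropy ((1 + dx) / 2);
             Ut_z = col (mat_diag 2 (\<lambda>i. if i = 0 then dz else dx) * U) 0;
             V_z = row V 0
         in is_maximum {min_K (case_prod params (compensate R t QA QB)) | QA QB. QA \<in> SO2 \<and> QB \<in> SO2} val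
          \<and> G2 R t = val
          \<and> is_minimum ((\<lambda>(R',t'). key_rate R' t') ` P_ba \<omega>s) val
          \<and> min_K \<omega>s = val
          \<and> (min_K (params R t) = min_K \<omega>s \<longleftrightarrow> (\<exists>c::real. Ut_z = c \<cdot>\<^sub>v V_z \<or> V_z = c \<cdot>\<^sub>v Ut_z))"
proof -
  obtain \<alpha> \<beta> where rot: "U = rot \<alpha>" "V = rot \<beta>" using U V by (elim SO2_cases)
  have inv: "QAs = rot (- \<alpha>)" "QBs = rot (- \<beta>)" using QAs QBs by (simp_all add: rot rot_left_inverse)
  have R: "R \<in> carrier_mat 3 3" using chan by (simp add: is_channel_def)
  have block: "zx_block R = rot \<beta> * zx_diag dz dx * rot \<alpha>" using svd by (simp add: zx_block_def rot)
  have params: "params R t = opt_params dz dx \<alpha> \<beta>" unfolding unital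
    by (rule params_eq_opt_params[OF block])
  note le_1 = channel_singular_values_le_1[OF chan params]
  note max = is_maximum_min_K_compensate[OF R block le_1]
  have \<omega>s: "case_prod params (compensate R t QAs QBs) = opt_params dz dx 0 0"
    unfolding unital inv params_compensate_rot[OF R block] by simp
  have min: "is_minimum ((\<lambda>(R,t). key_rate R t) ` P_ba (opt_params dz dx 0 0)) (opt_key_rate dz dx)"
    by (rule key_rate_opt_params_is_minimum[OF le_1]) (simp add: opt_R_index[unfolded One_nat_def])
  have "G2 R t = opt_key_rate dz dx"
    using max unfolding G2_def unital is_maximum_def by (auto intro: cSup_eq_maximum)
  thus ?thesis
    using max min min_K_eq_if_is_minimum[OF min] min_K_opt_params_eq_iff[OF le_1, of \<alpha> \<beta>]
      collinear_svd_iff[of dz dx \<alpha> \<beta>] \<omega>s unfolding Let_def split_def unital[symmetric] params rot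
        by simp
qed

end
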